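(* Let $q$ be a prime power and $n\ge 2$ with $\gcd(q,n)=1$. With the notation of the context, let the maps $\epsilon_j: A_j\to\mathbb{F}_qD_n$ ($1\le j\le r+s$) be defined as follows. 1) For $1\le j\le\zeta(n)$: $\epsilon_j: w_1+w_2h\mapsto (w_1+w_2b)\,e_{f_j}(a)$, $w_1,w_2\in\mathbb{F}_q$. 2) For $\zeta(n)+1\le j\le r$ and $M,N,P,Q\in\mathbb{F}_q[x]$: $$\epsilon_j:\begin{pmatrix} M(\alpha_j+\alpha_j^{-1}) & P(\alpha_j+\alpha_j^{-1})\\ N(\alpha_j+\alpha_j^{-1}) & Q(\alpha_j+\alpha_j^{-1})\end{pmatrix}\mapsto (T_1(a)+bT_2(a))\,e_{f_j}(a),$$ where $$T_1(a)=F_{j,1}(a)G_{j,1}(a)\left[-M(a+a^{-1})+aN(a+a^{-1})-aP(a+a^{-1})+a^2Q(a+a^{-1})\right],$$ $$T_2(a)=F_{j,1}(a)G_{j,1}(a)\left[-M(a+a^{-1})+a^{-1}N(a+a^{-1})-aP(a+a^{-1})+Q(a+a^{-1})\right].$$ 3) For $r+1\le j\le r+s$ and $M,N,P,Q\in\mathbb{F}_q[x]$: $$\epsilon_j:\begin{pmatrix} M(\alpha_j)&P(\alpha_j^{-1})\\N(\alpha_j)&Q(\alpha_j^{-1})\end{pmatrix}\mapsto [M(a)+bN(a)]\,e_{f_j}(a)+[Q(a)+bP(a)]\,e_{f_j^*}(a).$$ (In 2) and 3), elements of the field extensions are represented by polynomial expressions.) Then $\mathcal{P}^{-1}=\sum_{j=1}^{r+s}\epsilon_j$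 (that is, $\mathcal P^{-1}(w_1,\dots,w_{r+s})=\sum_j\epsilon_j(w_j)$), and the maps $\epsilon_j$ are $\mathbb{F}_q$-algebra monomorphisms such that $\mathcal{P}_j\epsilon_j=\mathrm{id}_{A_j}$ for all $j$, and $\mathcal{P}_i\epsilon_j=0$ for all $i\in\{1,\dots,r+s\}$ with $i\ne j$.
   Context: $D_n=\langle a,b\mid a^n=1,\ b^2=1,\ bab=a^{-1}\rangle$ is the dihedral group of order $2n$, $\mathbb{F}_qD_n$ its group algebra over the field $\mathbb F_q$ with $q$ elements; every element is uniquely $P(a)+bQ(a)$ with $P,Q\in\mathbb{F}_q[x]$ of degree less than $n$. For $g\in\mathbb{F}_q[x]$ with $g(0)\neq0$ put $g^*(x)=x^{\deg g}g(x^{-1})$. Factor $x^n-1$ over $\mathbb{F}_q$ into (pairwise distinct) monic irreducible factors as $x^n-1=(f_1f_2\cdots f_r)(f_{r+1}f_{r+1}^*\cdots f_{r+s}f_{r+s}^* )$, where $f_1=x-1$, $f_2=x+1$ if $n$ is even, $f_j^*=f_j$ for $1<j\le r$, and for $j>r$ the polynomials $f_j$ and $f_j^*$ have different roots (here the factor $f_j^*$, $j>r$, is normalized by a scalar to be monic). Let $\alpha_j$ be a root of $f_j$. Let $\zeta(n)=1$ if $n$ is odd, $\zeta(n)=2$ if $n$ is even. $\langle h\mid h^2\rangle$ is the cyclic group of order 2 generated by $h$, and $\mathrm{M}_2(F)$ is the algebra of $2\times2$ matrices over $F$. Put $A_j=\mathbb{F}_q\langle h\mid h^2\rangle$ for $1\le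 j\le\zeta(n)$, $A_j=\mathrm{M}_2(\mathbb{F}_q[\alpha_j+\alpha_j^{-1}])$ for $\zeta(n)+1\le j\le r$, $A_j=\mathrm{M}_2(\mathbb{F}_q[\alpha_j])$ for $r+1\le j\le r+s$. Define for $u=P(a)+bQ(a)$: $\gamma_1(u)=P(1)+Q(1)h$; $\gamma_2(u)=P(-1)+Q(-1)h$ (for $n$ even); for $j\ge\zeta(n)+1$, $\tau_j(u)=\begin{pmatrix}P(\alpha_j)&Q(\alpha_j^{-1})\\Q(\alpha_j)&P(\alpha_j^{-1})\end{pmatrix}\in \mathrm{M}_2(\mathbb{F}_q[\alpha_j])$; for $\zeta(n)+1\le j\le r$, $\sigma_j(X)=Z_j^{-1}XZ_j$ with $Z_j=\begin{pmatrix}1&-\alpha_j\\1&-\alpha_j^{-1}\end{pmatrix}$. Put $\mathcal{P}_j=\gamma_j$ for $j\le\zeta(n)$, $\mathcal{P}_j=\sigma_j\tau_j$ for $\zeta(n)+1\le j\le r$, $\mathcal{P}_j=\tau_j$ for $r+1\le j\le r+s$. It is known that $\mathcal{P}=\bigoplus_{j=1}^{r+s}\mathcal{P}_j:\mathbb{F}_qD_n\to\bigoplus_{j=1}^{r+s}A_j$ is an algebra isomorphism. For a monic divisor $g$ of $x^n-1$ put $e_g(x)=-\frac{x^{\deg g-1}\,(g^* )'(x^{-1})}{n}\cdot\frac{x^n-1}{g(x)}$ (with $g^*(x)=x^{\deg g}g(x^{-1})$ unnormalized and $'$ the formal derivative); this polynomial takes the value 1 at the roots of $g$ and 0 at the other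 roots of $x^n-1$. For $\zeta(n)+1\le j\le r$ let $F_{j,1},F_{j,2},G_{j,1},G_{j,2}\in\mathbb{F}_q[x]$ satisfy the Bezout relations $(x-1)F_{j,1}+f_jF_{j,2}=1$ and $(x+1)G_{j,1}+f_jG_{j,2}=1$. An $\mathbb{F}_q$-algebra monomorphism here means an injective $\mathbb{F}_q$-linear multiplicative map (not required to preserve the identity). *)

theory Defs
  imports
    "HOL-Analysis.Analysis"
    "HOL-Library.Poly_Mapping"
    "HOL-Library.Z2"
    "HOL-Algebra.Module"
    "HOL-Algebra.Algebraic_Closure_Type"
    "Berlekamp_Zassenhaus.Finite_Field"
begin

section \<open>The dihedral group\<close>

text \<open>
  The dihedral group of order \<open>2 * CARD('n)\<close>; \<open>Dih i k\<close> is the element \<open>b\<^sup>i a\<^sup>k\<close>.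
  The group is written additively (and is not commutative), because the convolution product of
  \<^typ>\<open>'g \<Rightarrow>\<^sub>0 'k\<close> is based on an additive monoid \<^typ>\<open>'g\<close>.  The product below is
  \<open>b\<^sup>i a\<^sup>k b\<^sup>j a\<^sup>l = b\<^sup>i\<^sup>+\<^sup>j a\<^sup>m\<close> with \<open>m = k + l\<close> if \<open>j = 0\<close> and \<open>m = - k + l\<close> if \<open>j = 1\<close>.
  The class \<open>nontriv\<close> says \<open>CARD('n) \<ge> 2\<close>.
\<close>

datatype 'n dih = Dih bit "'n mod_ring"

instantiation dih :: (nontriv) group_add
begin

fun plus_dih :: "'a dih \<Rightarrow> 'a dih \<Rightarrow> 'a dih" where
  "Dih i k + Dih j l = Dih (i + j) ((if j = 0 then k else - k) + l)"

definition zero_dih :: "'a dih" where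
  "0 = Dih 0 0"

fun uminus_dih :: "'a dih \<Rightarrow> 'a dih" where
  "- Dih i k = Dih i (if i = 0 then - k else k)"

definition minus_dih :: "'a dih \<Rightarrow> 'a dih \<Rightarrow> 'a dih" where
  "x - y = x + - (y :: 'a dih)"

instance
proof
  fix x y z :: "'a dih"
  have bit_cases: "i = 0 \<or> i = 1" for i :: bit
    by (cases i) auto
  show "x + y + z = x + (y + z)"
  proof (cases x; cases y; cases z)
    fix i j l :: bit and k m p :: "'a mod_ring"
    assume "x = Dih i k" "y = Dih j m" "z = Dih l p"
    then show ?thesis
      using bit_cases[of j] bit_cases[of l] by (auto simp: algebra_simps)
  qed
  show "0 + x = x"
    by (cases x) (auto simp: zero_dih_def)
  show "x + 0 = x"
    by (cases x) (auto simp: zero_dih_def)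
  show "- x + x = 0"
  proof (cases x)
    case (Dih i k)
    then show ?thesis
      using bit_cases[of i] by (auto simp: zero_dih_def)
  qed
  show "x + - y = x - y"
    by (simp add: minus_dih_def)
qed

end

lemma UNIV_mod_ring: "(UNIV :: 'n :: nontriv mod_ring set) = of_nat ` {..<CARD('n)}"
proof -
  have "x \<in> of_nat ` {..<CARD('n)}" for x :: "'n mod_ring"
  proof
    have r: "to_int_mod_ring x \<in> {0..<int CARD('n)}"
      using range_to_int_mod_ring[where 'a = 'n] by auto
    then show "nat (to_int_mod_ring x) \<in> {..<CARD('n)}"
      by (auto simp: nat_less_iff)
    show "x = of_nat (nat (to_int_mod_ring x))"
      using r by (simp add: of_nat_of_int_mod_ring)
  qed
  then show ?thesis
    by blast
qed

lemma inj_on_of_nat_mod_ring: "inj_on (of_nat :: nat \<Rightarrow> 'n :: nontriv mod_ring) {..<CARD('n)}"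
  by (rule eq_card_imp_inj_on) (simp, subst UNIV_mod_ring[symmetric], simp)

lemma card_dih: "CARD('n :: nontriv dih) = 2 * CARD('n)"
proof -
  have bit: "(UNIV :: bit set) = {0, 1}"
    by (auto simp: bit_not_zero_iff)
  have "bij_betw (\<lambda>(i, k). Dih i k) (UNIV :: (bit \<times> 'n mod_ring) set) UNIV"
  proof (rule bij_betwI[where g = "\<lambda>g. case g of Dih i k \<Rightarrow> (i, k)"])
    show "(\<lambda>(i, k). Dih i k) (case g of Dih i k \<Rightarrow> (i, k)) = g" for g :: "'n dih"
      by (simp split: dih.split)
  qed auto
  then have "CARD('n dih) = CARD(bit \<times> 'n mod_ring)"
    using bij_betw_same_card by metis
  then show ?thesis
    by (simp add: bit)
qed

section \<open>Group algebras\<close>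

definition scal :: "'k :: semiring_1 \<Rightarrow> ('g :: monoid_add \<Rightarrow>\<^sub>0 'k)" where
  "scal c = Poly_Mapping.single 0 c"

definition grp_alg :: "('k :: semiring_1, 'g :: monoid_add \<Rightarrow>\<^sub>0 'k) module" where
  "grp_alg = \<lparr>carrier = UNIV, monoid.mult = (*), one = 1, ring.zero = 0, add = (+),
              smult = (\<lambda>c u. scal c * u)\<rparr>"

abbreviation gen_a :: "'n :: nontriv dih \<Rightarrow>\<^sub>0 'k :: field" where
  "gen_a \<equiv> Poly_Mapping.single (Dih 0 1) 1"

abbreviation gen_a_inv :: "'n :: nontriv dih \<Rightarrow>\<^sub>0 'k :: field" where
  "gen_a_inv \<equiv> Poly_Mapping.single (Dih 0 (- 1)) 1"

abbreviation gen_b :: "'n :: nontriv dih \<Rightarrow>\<^sub>0 'k :: field" where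
  "gen_b \<equiv> Poly_Mapping.single (Dih 1 0) 1"

lemma gen_a_power: "gen_a ^ k = Poly_Mapping.single (Dih 0 (of_nat k)) 1"
  proof (induction k)
  case 0
  then show ?case
    by (simp add: single_one[symmetric] zero_dih_def del: single_one)
next
  case (Suc k)
  then show ?case
    by (simp add: mult_single)
qed

lemma gen_b_gen_a_power:
  "gen_b * gen_a ^ k = Poly_Mapping.single (Dih 1 (of_nat k)) 1"
  by (simp add: gen_a_power mult_single)

lemma gen_relations:
  "(gen_a :: 'n :: nontriv dih \<Rightarrow>\<^sub>0 'k :: field) ^ CARD('n) = 1"
  "(gen_b :: 'n dih \<Rightarrow>\<^sub>0 'k) ^ 2 = 1"
  "gen_b * gen_a * gen_b = (gen_a_inv :: 'n dih \<Rightarrow>\<^sub>0 'k)"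
  "gen_a * gen_a_inv = (1 :: 'n dih \<Rightarrow>\<^sub>0 'k)"
  "gen_a_inv * gen_a = (1 :: 'n dih \<Rightarrow>\<^sub>0 'k)"
  by (simp_all add: gen_a_power mult_single power2_eq_square flip: zero_dih_def)

text \<open>The cyclic group of order 2 is the additive group of \<^typ>\<open>bit\<close>.\<close>

abbreviation gen_h :: "bit \<Rightarrow>\<^sub>0 'k :: field" where
  "gen_h \<equiv> Poly_Mapping.single 1 1"

text \<open>The value of a polynomial at an element of a (possibly noncommutative) group algebra.\<close>

definition aeval :: "'k :: field poly \<Rightarrow> ('g :: monoid_add \<Rightarrow>\<^sub>0 'k) \<Rightarrow> ('g \<Rightarrow>\<^sub>0 'k)" where
  "aeval p u = (\<Sum>i\<le>Polynomial.degree p. scal (Polynomial.coeff p i) * u ^ i)"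

text \<open>
  \<open>P_part u\<close> and \<open>Q_part u\<close> are the polynomials \<open>P\<close> and \<open>Q\<close> of degree less than \<open>CARD('n)\<close>
  with \<open>u = P(a) + b Q(a)\<close>; see \<open>dih_alg_decomp\<close> and \<open>dih_alg_decomp_unique\<close>.
\<close>

definition P_part :: "('n :: nontriv dih \<Rightarrow>\<^sub>0 'k :: field) \<Rightarrow> 'k poly" where
  "P_part u = (\<Sum>k<CARD('n). Polynomial.monom (Poly_Mapping.lookup u (Dih 0 (of_nat k))) k)"

definition Q_part :: "('n :: nontriv dih \<Rightarrow>\<^sub>0 'k :: field) \<Rightarrow> 'k poly" where
  "Q_part u = (\<Sum>k<CARD('n). Polynomial.monom (Poly_Mapping.lookup u (Dih 1 (of_nat k))) k)"

lemma scal_single: "scal c * Poly_Mapping.single g 1 = Poly_Mapping.single g c"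
  by (simp add: scal_def mult_single)

lemma coeff_P_part:
  "Polynomial.coeff (P_part (u :: 'n :: nontriv dih \<Rightarrow>\<^sub>0 'k :: field)) k
    = (if k < CARD('n) then Poly_Mapping.lookup u (Dih 0 (of_nat k)) else 0)"
  by (simp add: P_part_def coeff_sum)

lemma coeff_Q_part:
  "Polynomial.coeff (Q_part (u :: 'n :: nontriv dih \<Rightarrow>\<^sub>0 'k :: field)) k
    = (if k < CARD('n) then Poly_Mapping.lookup u (Dih 1 (of_nat k)) else 0)"
  by (simp add: Q_part_def coeff_sum)

lemma degree_sum_monom_less: "0 < n \<Longrightarrow> Polynomial.degree (\<Sum>k<n. Polynomial.monom (c k) k) < n"
  by (rule degree_lessI) (auto simp: coeff_sum)

lemma aeval_gen_a:
  assumes "Polynomial.degree p < m"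
  shows "(aeval p gen_a :: 'n :: nontriv dih \<Rightarrow>\<^sub>0 'k :: field) =
    (\<Sum>k<m. Poly_Mapping.single (Dih 0 (of_nat k)) (Polynomial.coeff p k))"
proof -
  have "(\<Sum>k<m. Poly_Mapping.single (Dih 0 (of_nat k) :: 'n dih) (Polynomial.coeff p k))
      = (\<Sum>k\<le>Polynomial.degree p. Poly_Mapping.single (Dih 0 (of_nat k)) (Polynomial.coeff p k))"
    by (rule sum.mono_neutral_right) (use assms in \<open>auto simp: coeff_eq_0\<close>)
  then show ?thesis
    by (simp add: aeval_def gen_a_power scal_single)
qed

lemma gen_b_aeval_gen_a:
  assumes "Polynomial.degree p < m"
  shows "gen_b * aeval p gen_a = (\<Sum>k<m. Poly_Mapping.single (Dih 1 (of_nat k)) (Polynomial.coeff p k))"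
  by (simp add: aeval_gen_a[OF assms] sum_distrib_left mult_single)

lemma lookup_decomp:
  fixes P Q :: "'k :: field poly"
  assumes "Polynomial.degree P < CARD('n :: nontriv)" "Polynomial.degree Q < CARD('n)" and k: "k < CARD('n)"
  defines "u \<equiv> (aeval P gen_a + gen_b * aeval Q gen_a :: 'n dih \<Rightarrow>\<^sub>0 'k)"
  shows "Poly_Mapping.lookup u (Dih 0 (of_nat k)) = Polynomial.coeff P k"
    and "Poly_Mapping.lookup u (Dih 1 (of_nat k)) = Polynomial.coeff Q k"
proof -
  have eq: "(of_nat l :: 'n mod_ring) = of_nat k \<longleftrightarrow> l = k" if "l \<in> {..<CARD('n)}" for l
    using inj_on_of_nat_mod_ring[where 'n = 'n] that k by (auto simp: inj_on_def)
  have sum: "(\<Sum>l<CARD('n). c l when (of_nat l :: 'n mod_ring) = of_nat k) = c k"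
    for c :: "nat \<Rightarrow> 'k"
  proof -
    have "(\<Sum>l<CARD('n). c l when (of_nat l :: 'n mod_ring) = of_nat k)
        = (\<Sum>l<CARD('n). if l = k then c l else 0)"
      by (rule sum.cong) (auto simp: eq when_def)
    then show ?thesis
      using k by (simp add: sum.delta)
  qed
  show "Poly_Mapping.lookup u (Dih 0 (of_nat k)) = Polynomial.coeff P k"
    and "Poly_Mapping.lookup u (Dih 1 (of_nat k)) = Polynomial.coeff Q k"
    unfolding u_def
    by (simp_all add: aeval_gen_a[OF assms(1)] gen_b_aeval_gen_a[OF assms(2)] lookup_add
          lookup_sum lookup_single sum)
qed

lemma dih_alg_decomp_unique:
  fixes P Q :: "'k :: field poly"
  assumes "Polynomial.degree P < CARD('n :: nontriv)" "Polynomial.degree Q < CARD('n)"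
  defines "u \<equiv> (aeval P gen_a + gen_b * aeval Q gen_a :: 'n dih \<Rightarrow>\<^sub>0 'k)"
  shows "P_part u = P" "Q_part u = Q"
  unfolding u_def poly_eq_iff
  using lookup_decomp[OF assms(1,2)] coeff_eq_0[of P] coeff_eq_0[of Q] assms(1,2)
  by (simp_all add: coeff_P_part coeff_Q_part)

lemma dih_alg_decomp:
  fixes u :: "'n :: nontriv dih \<Rightarrow>\<^sub>0 'k :: field"
  shows "Polynomial.degree (P_part u) < CARD('n)" "Polynomial.degree (Q_part u) < CARD('n)"
    and "u = aeval (P_part u) gen_a + gen_b * aeval (Q_part u) gen_a"
proof -
  show P: "Polynomial.degree (P_part u) < CARD('n)" and Q: "Polynomial.degree (Q_part u) < CARD('n)"
    by (simp_all add: P_part_def Q_part_def degree_sum_monom_less)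
  show "u = aeval (P_part u) gen_a + gen_b * aeval (Q_part u) gen_a"
  proof (rule poly_mapping_eqI)
    fix g :: "'n dih"
    obtain i m where "g = Dih i m"
      by (cases g)
    moreover obtain k where "m = of_nat k" "k < CARD('n)"
      using UNIV_mod_ring[where 'n = 'n] by (metis UNIV_I imageE lessThan_iff)
    ultimately show "Poly_Mapping.lookup u g =
        Poly_Mapping.lookup (aeval (P_part u) gen_a + gen_b * aeval (Q_part u) gen_a) g"
      using lookup_decomp[OF P Q, of k] by (cases i) (simp_all add: coeff_P_part coeff_Q_part)
  qed
qed

section \<open>Simple components\<close>

text \<open>\<open>ac_eval p x\<close> is \<open>p(x)\<close> and \<open>adjoin x\<close> is \<open>k[x]\<close>, for \<open>x\<close> in the algebraic closure of \<open>k\<close>.\<close>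

definition ac_eval :: "'k :: field poly \<Rightarrow> 'k alg_closure \<Rightarrow> 'k alg_closure" where
  "ac_eval p x = poly (map_poly to_ac p) x"

definition adjoin :: "'k :: field alg_closure \<Rightarrow> 'k alg_closure set" where
  "adjoin x = range (\<lambda>p. ac_eval p x)"

definition mat2 :: "'c :: zero \<Rightarrow> 'c \<Rightarrow> 'c \<Rightarrow> 'c \<Rightarrow> 'c ^ 2 ^ 2" where
  "mat2 x y z w = vector [vector [x, y], vector [z, w]]"

definition mat_alg :: "'k :: field alg_closure set \<Rightarrow> ('k, 'k alg_closure ^ 2 ^ 2) module" where
  "mat_alg K = \<lparr>carrier = {Y. \<forall>i j. Y $ i $ j \<in> K}, monoid.mult = (**), one = mat 1,
                ring.zero = 0, add = (+), smult = (\<lambda>c Y. \<chi> i j. to_ac c * Y $ i $ j)\<rparr>"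

text \<open>A common type for the elements of all components (\<^const>\<open>Inl\<close> for the group algebras,
  \<^const>\<open>Inr\<close> for the matrix algebras), with the algebra structures moved along the injections.\<close>

type_synonym 'k comp = "(bit \<Rightarrow>\<^sub>0 'k) + ('k alg_closure ^ 2 ^ 2)"

definition relabel :: "('x \<Rightarrow> 'y) \<Rightarrow> ('y \<Rightarrow> 'x) \<Rightarrow> ('k, 'x) module \<Rightarrow> ('k, 'y) module" where
  "relabel C D R =
     \<lparr>carrier = C ` carrier R,
      monoid.mult = (\<lambda>x y. C (D x \<otimes>\<^bsub>R\<^esub> D y)), one = C \<one>\<^bsub>R\<^esub>,
      ring.zero = C \<zero>\<^bsub>R\<^esub>, add = (\<lambda>x y. C (D x \<oplus>\<^bsub>R\<^esub> D y)),
      smult = (\<lambda>c x. C (c \<odot>\<^bsub>R\<^esub> D x))\<rparr>"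

definition zeta :: "nat \<Rightarrow> nat" where
  "zeta n = (if odd n then 1 else 2)"

definition comp_alg ::
    "nat \<Rightarrow> nat \<Rightarrow> (nat \<Rightarrow> 'k :: field alg_closure) \<Rightarrow> nat \<Rightarrow> ('k, 'k comp) module" where
  "comp_alg n r \<alpha> j =
     (if j \<le> zeta n then relabel Inl projl grp_alg
      else if j \<le> r then relabel Inr projr (mat_alg (adjoin (\<alpha> j + inverse (\<alpha> j))))
      else relabel Inr projr (mat_alg (adjoin (\<alpha> j))))"

section \<open>The projections\<close>

definition gam :: "nat \<Rightarrow> ('n :: nontriv dih \<Rightarrow>\<^sub>0 'k :: field) \<Rightarrow> (bit \<Rightarrow>\<^sub>0 'k)" where
  "gam j u = (let c = if j = 1 then 1 else - 1
              in scal (poly (P_part u) c) + scal (poly (Q_part u) c) * gen_h)"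

definition tau ::
    "'k :: field alg_closure \<Rightarrow> ('n :: nontriv dih \<Rightarrow>\<^sub>0 'k) \<Rightarrow> 'k alg_closure ^ 2 ^ 2" where
  "tau x u = mat2 (ac_eval (P_part u) x) (ac_eval (Q_part u) (inverse x))
                  (ac_eval (Q_part u) x) (ac_eval (P_part u) (inverse x))"

definition Zmat :: "'c :: field \<Rightarrow> 'c ^ 2 ^ 2" where
  "Zmat x = mat2 1 (- x) 1 (- inverse x)"

definition sig :: "'c :: field \<Rightarrow> 'c ^ 2 ^ 2 \<Rightarrow> 'c ^ 2 ^ 2" where
  "sig x Y = matrix_inv (Zmat x) ** Y ** Zmat x"

definition proj ::
    "nat \<Rightarrow> nat \<Rightarrow> (nat \<Rightarrow> 'k :: field alg_closure) \<Rightarrow> nat \<Rightarrow>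
     ('n :: nontriv dih \<Rightarrow>\<^sub>0 'k) \<Rightarrow> 'k comp" where
  "proj n r \<alpha> j u =
     (if j \<le> zeta n then Inl (gam j u)
      else if j \<le> r then Inr (sig (\<alpha> j) (tau (\<alpha> j) u))
      else Inr (tau (\<alpha> j) u))"

section \<open>The maps in the opposite direction\<close>

text \<open>\<^const>\<open>reflect_poly\<close> \<open>g\<close> is \<open>g\<^sup>*\<close>; \<open>mrecip g\<close> is \<open>g\<^sup>*\<close> scaled to be monic.\<close>

definition mrecip :: "'k :: field poly \<Rightarrow> 'k poly" where
  "mrecip g = Polynomial.smult (inverse (Polynomial.lead_coeff (reflect_poly g))) (reflect_poly g)"

text \<open>\<open>rev_poly m p\<close> is \<open>x\<^sup>m p(x\<^sup>-\<^sup>1)\<close>, for \<open>degree p \<le> m\<close>.\<close>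

definition rev_poly :: "nat \<Rightarrow> 'k :: field poly \<Rightarrow> 'k poly" where
  "rev_poly m p = (\<Sum>i\<le>Polynomial.degree p. Polynomial.monom (Polynomial.coeff p i) (m - i))"

definition e_poly :: "nat \<Rightarrow> 'k :: field poly \<Rightarrow> 'k poly" where
  "e_poly n g =
     - Polynomial.smult (inverse (of_nat n)) (rev_poly (Polynomial.degree g - 1) (pderiv (reflect_poly g)))
       * ((Polynomial.monom 1 n - 1) div g)"

text \<open>\<open>eps_graph n r f F G \<alpha> j Y u\<close> says that the formula for \<open>\<epsilon>\<^sub>j\<close>, applied to some
  representation of \<open>Y\<close> by polynomials, has the value \<open>u\<close>.  The families \<open>F\<close> and \<open>G\<close> consist of
  the first Bezout coefficients.  The formula only defines a map if the value does not depend on the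
  representation and every element of the component has one; this is to be proved.\<close>

inductive eps_graph ::
    "nat \<Rightarrow> nat \<Rightarrow> (nat \<Rightarrow> 'k :: field poly) \<Rightarrow> (nat \<Rightarrow> 'k poly) \<Rightarrow> (nat \<Rightarrow> 'k poly) \<Rightarrow>
     (nat \<Rightarrow> 'k alg_closure) \<Rightarrow> nat \<Rightarrow> 'k comp \<Rightarrow> ('n :: nontriv dih \<Rightarrow>\<^sub>0 'k) \<Rightarrow> bool"
  for n r f F G \<alpha> j where
  cyc: "j \<le> zeta n \<Longrightarrow>
    eps_graph n r f F G \<alpha> j
      (Inl (scal w1 + scal w2 * gen_h))
      ((scal w1 + scal w2 * gen_b) * aeval (e_poly n (f j)) gen_a)"
| self_recip: "zeta n < j \<Longrightarrow> j \<le> r \<Longrightarrow>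
    x = \<alpha> j + inverse (\<alpha> j) \<Longrightarrow>
    c = gen_a + gen_a_inv \<Longrightarrow>
    T1 = aeval (F j) gen_a * aeval (G j) gen_a *
           (- aeval M c + gen_a * aeval N c - gen_a * aeval P c + gen_a ^ 2 * aeval Q c) \<Longrightarrow>
    T2 = aeval (F j) gen_a * aeval (G j) gen_a *
           (- aeval M c + gen_a_inv * aeval N c - gen_a * aeval P c + aeval Q c) \<Longrightarrow>
    eps_graph n r f F G \<alpha> j
      (Inr (mat2 (ac_eval M x) (ac_eval P x)
                 (ac_eval N x) (ac_eval Q x)))
      ((T1 + gen_b * T2) * aeval (e_poly n (f j)) gen_a)"
| pair: "zeta n < j \<Longrightarrow> r < j \<Longrightarrow>
    eps_graph n r f F G \<alpha> j
      (Inr (mat2 (ac_eval M (\<alpha> j)) (ac_eval P (inverse (\<alpha> j)))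
                 (ac_eval N (\<alpha> j)) (ac_eval Q (inverse (\<alpha> j)))))
      ((aeval M gen_a + gen_b * aeval N gen_a) * aeval (e_poly n (f j)) gen_a
        + (aeval Q gen_a + gen_b * aeval P gen_a) * aeval (e_poly n (mrecip (f j))) gen_a)"

definition eps ::
    "nat \<Rightarrow> nat \<Rightarrow> (nat \<Rightarrow> 'k :: field poly) \<Rightarrow> (nat \<Rightarrow> 'k poly) \<Rightarrow> (nat \<Rightarrow> 'k poly) \<Rightarrow>
     (nat \<Rightarrow> 'k alg_closure) \<Rightarrow> nat \<Rightarrow> 'k comp \<Rightarrow> ('n :: nontriv dih \<Rightarrow>\<^sub>0 'k)" where
  "eps n r f F G \<alpha> j Y = (THE u. eps_graph n r f F G \<alpha> j Y u)"

section \<open>Algebra monomorphisms\<close>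

text \<open>Not required to preserve the unit element.\<close>

definition alg_mono :: "('k, 'x) module \<Rightarrow> ('k, 'y) module \<Rightarrow> ('x \<Rightarrow> 'y) \<Rightarrow> bool" where
  "alg_mono A B \<phi> \<longleftrightarrow>
     \<phi> \<in> carrier A \<rightarrow> carrier B \<and> inj_on \<phi> (carrier A) \<and>
     (\<forall>x\<in>carrier A. \<forall>y\<in>carrier A. \<phi> (x \<oplus>\<^bsub>A\<^esub> y) = \<phi> x \<oplus>\<^bsub>B\<^esub> \<phi> y) \<and>
     (\<forall>c. \<forall>x\<in>carrier A. \<phi> (c \<odot>\<^bsub>A\<^esub> x) = c \<odot>\<^bsub>B\<^esub> \<phi> x) \<and>
     (\<forall>x\<in>carrier A. \<forall>y\<in>carrier A. \<phi> (x \<otimes>\<^bsub>A\<^esub> y) = \<phi> x \<otimes>\<^bsub>B\<^esub> \<phi> y)"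

end

theory Submission
  imports Defs
begin

text \<open>
  Everything follows from the values of the projections \<open>\<P>\<^sub>i\<close> on the elements that the formulas for
  \<open>\<epsilon>\<^sub>j\<close> produce: if \<open>u\<close> results from some polynomial representation of \<open>Y \<in> A\<^sub>j\<close>, then \<open>\<P>\<^sub>j(u) = Y\<close> and
  \<open>\<P>\<^sub>i(u) = 0\<close> for \<open>i \<noteq> j\<close> (\<open>proj_eps_graph\<close>, \<open>proj_other_eps_graph\<close>).  The projections are algebra
  homomorphisms into the components (\<open>proj_add\<close>, \<open>proj_mult\<close>, \<open>proj_smult\<close>, \<open>proj_closed\<close>), and together
  they are injective (\<open>proj_jointly_inj\<close>).  Hence \<open>u\<close> depends only on \<open>Y\<close>, the sum of the \<open>\<epsilon>\<^sub>j\<close> is a right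
  inverse of \<open>\<P>\<close> and so, \<open>\<P>\<close> being injective, its inverse, and the \<open>\<epsilon>\<^sub>j\<close> inherit additivity,
  linearity and multiplicativity: it suffices to compare components.

  The values come from three facts.  First, \<open>\<tau>\<close> and \<open>\<gamma>\<close> are multiplicative (\<open>tau_mult\<close>, \<open>gam_mult\<close>), so
  that the image of a polynomial in \<open>a\<close> is given by its values at \<open>\<alpha>\<^sub>j\<close> and \<open>\<alpha>\<^sub>j\<^sup>-\<^sup>1\<close>.  Secondly, \<open>e\<^sub>g\<close>
  is 1 at the roots of \<open>g\<close> and 0 at the other \<open>n\<close>-th roots of unity (\<open>ac_eval_e_poly\<close>); therefore
  \<open>e\<^sub>g(a)\<close> removes the components to which \<open>g\<close> does not belong.  Thirdly, at a self-reciprocal factor the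
  product of the Bezout coefficients has the value \<open>(\<alpha>\<^sub>j\<^sup>2 - 1)\<^sup>-\<^sup>1\<close> (\<open>bezout_at_roots\<close>), and with this
  factor the expressions \<open>T\<^sub>1\<close> and \<open>T\<^sub>2\<close> are the entries of the matrix that \<open>Z\<^sub>j\<close> conjugates to the
  given one (\<open>companion_identities\<close>).

  Injectivity rests on separability: \<open>n\<close> is invertible in the field, so \<open>x\<^sup>n - 1\<close> has only simple roots.
  Since the \<open>f\<^sub>j\<close> are irreducible, a polynomial over the field that vanishes at all \<open>\<alpha>\<^sub>j\<close> and
  \<open>\<alpha>\<^sub>j\<^sup>-\<^sup>1\<close> vanishes at all \<open>n\<close>-th roots of unity, and it is 0 if its degree is less than \<open>n\<close>.
  Separability also keeps the roots that belong to different indices apart.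
\<close>

section \<open>Evaluation of polynomials in the algebraic closure\<close>

lemma ac_eval_sum:
  assumes "Polynomial.degree p < m"
  shows "ac_eval p x = (\<Sum>k<m. to_ac (Polynomial.coeff p k) * x ^ k)"
proof -
  have "(\<Sum>k<m. to_ac (Polynomial.coeff p k) * x ^ k)
      = (\<Sum>k\<le>Polynomial.degree p. to_ac (Polynomial.coeff p k) * x ^ k)"
    by (rule sum.mono_neutral_right) (use assms in \<open>auto simp: coeff_eq_0\<close>)
  then show ?thesis
    by (simp add: ac_eval_def poly_altdef degree_map_poly coeff_map_poly)
qed

lemma ac_eval_add: "ac_eval (p + q) x = ac_eval p x + ac_eval q x"
proof -
  have "map_poly to_ac (p + q) = map_poly to_ac p + map_poly to_ac q"
    by (rule poly_eqI) (simp add: coeff_map_poly)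
  then show ?thesis
    by (simp add: ac_eval_def)
qed

lemma ac_eval_uminus: "ac_eval (- p) x = - ac_eval p x"
proof -
  have "map_poly to_ac (- p) = - map_poly to_ac p"
    by (rule poly_eqI) (simp add: coeff_map_poly)
  then show ?thesis
    by (simp add: ac_eval_def)
qed

lemma ac_eval_diff: "ac_eval (p - q) x = ac_eval p x - ac_eval q x"
  using ac_eval_add[of p "- q" x] by (simp add: ac_eval_uminus)

lemma ac_eval_mult: "ac_eval (p * q) x = ac_eval p x * ac_eval q x"
proof -
  have "map_poly to_ac (p * q) = map_poly to_ac p * map_poly to_ac q"
    by (rule poly_eqI) (simp add: coeff_map_poly coeff_mult to_ac_sum)
  then show ?thesis
    by (simp add: ac_eval_def)
qed

lemma ac_eval_monom: "ac_eval (Polynomial.monom c k) x = to_ac c * x ^ k"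
  by (simp add: ac_eval_def map_poly_monom poly_monom)

lemma ac_eval_const: "ac_eval [:c:] x = to_ac c"
  using ac_eval_monom[of c 0 x] by (simp add: monom_0)

lemma ac_eval_pCons: "ac_eval (pCons c p) x = to_ac c + x * ac_eval p x"
proof -
  have "map_poly to_ac (pCons c p) = pCons (to_ac c) (map_poly to_ac p)"
    by (rule poly_eqI) (simp add: coeff_map_poly coeff_pCons split: nat.split)
  then show ?thesis
    by (simp add: ac_eval_def)
qed

lemma ac_eval_0: "ac_eval 0 x = 0"
  by (simp add: ac_eval_def)

lemma ac_eval_1: "ac_eval 1 x = 1"
  by (simp add: ac_eval_def)

lemma ac_eval_smult: "ac_eval (Polynomial.smult c p) x = to_ac c * ac_eval p x"
  using ac_eval_mult[of "[:c:]" p x] by (simp add: ac_eval_const)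

lemma ac_eval_prod: "ac_eval (\<Prod>i\<in>I. p i) x = (\<Prod>i\<in>I. ac_eval (p i) x)"
  by (induction I rule: infinite_finite_induct) (auto simp: ac_eval_1 ac_eval_mult)

lemmas ac_eval_simps = ac_eval_add ac_eval_uminus ac_eval_diff ac_eval_mult ac_eval_monom
  ac_eval_pCons ac_eval_0 ac_eval_1 ac_eval_smult

lemma ac_eval_to_ac: "ac_eval p (to_ac c) = to_ac (poly p c)"
  by (simp add: ac_eval_def poly_altdef degree_map_poly coeff_map_poly to_ac_sum)

lemma ac_eval_reflect_poly:
  assumes "x \<noteq> 0"
  shows "ac_eval (reflect_poly p) x = x ^ Polynomial.degree p * ac_eval p (inverse x)"
proof -
  have "map_poly to_ac (reflect_poly p) = reflect_poly (map_poly to_ac p)"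
    by (rule poly_eqI) (auto simp: coeff_map_poly coeff_reflect_poly degree_map_poly)
  then show ?thesis
    using assms by (simp add: ac_eval_def poly_reflect_poly_nz degree_map_poly)
qed

section \<open>Roots of unity and the polynomials \<open>e\<^sub>g\<close>\<close>

text \<open>
  Splitting off one linear factor \<open>x - a\<close> keeps both hypotheses: as \<open>a\<close> is a simple root of
  \<open>p = (x - a) p\<^sub>1\<close>, the roots of \<open>p\<^sub>1\<close> differ from \<open>a\<close>, so they remain roots of \<open>q / (x - a)\<close>.
\<close>

lemma poly_dvd_if_simple_roots:
  fixes p q :: "'a :: alg_closed_field poly"
  assumes "p \<noteq> 0" and "\<And>x. poly p x = 0 \<Longrightarrow> poly (pderiv p) x \<noteq> 0"
    and "\<And>x. poly p x = 0 \<Longrightarrow> poly q x = 0"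
  shows "p dvd q"
  using assms
proof (induction "Polynomial.degree p" arbitrary: p q)
  case 0
  then show ?case
    by (metis is_unit_iff_degree unit_imp_dvd)
next
  case (Suc d)
  then obtain a where a: "poly p a = 0"
    using alg_closed_imp_poly_has_root[of p] by auto
  then obtain p1 where p1: "p = [:- a, 1:] * p1"
    by (auto simp: poly_eq_0_iff_dvd)
  obtain q1 where q1: "q = [:- a, 1:] * q1"
    using Suc.prems(3)[OF a] by (auto simp: poly_eq_0_iff_dvd)
  have p1_nz: "p1 \<noteq> 0"
    using Suc.prems(1) p1 by auto
  have deriv: "poly (pderiv p) x = (x - a) * poly (pderiv p1) x + poly p1 x" for x
    unfolding p1 pderiv_mult by (simp add: pderiv_pCons algebra_simps)
  have "poly p1 a \<noteq> 0"
    using Suc.prems(2)[OF a] deriv[of a] by simp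
  then have root: "poly p x = 0 \<and> x \<noteq> a" if "poly p1 x = 0" for x
    using that by (auto simp: p1)
  have "p1 dvd q1"
  proof (rule Suc.hyps(1))
    show "d = Polynomial.degree p1"
      using Suc.hyps(2) p1 p1_nz by (simp add: degree_mult_eq del: mult_pCons_left)
    show "poly (pderiv p1) x \<noteq> 0" if "poly p1 x = 0" for x
      using Suc.prems(2) root[OF that] deriv[of x] that by auto
    show "poly q1 x = 0" if "poly p1 x = 0" for x
      using Suc.prems(3) root[OF that] by (auto simp: q1)
  qed (rule p1_nz)
  then show ?case
    unfolding p1 q1 by (rule mult_dvd_mono[OF dvd_refl])
qed

text \<open>
  Since \<open>n\<close> is invertible, \<open>x\<^sup>n - 1\<close> has only simple roots, so it divides every polynomial that
  vanishes at all of them.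
\<close>

lemma eq_0_if_vanishes_on_unity_roots:
  fixes p :: "'k :: field poly"
  assumes n: "of_nat n \<noteq> (0 :: 'k)" and deg: "Polynomial.degree p < n"
    and zero: "\<And>x. x ^ n = 1 \<Longrightarrow> ac_eval p x = 0"
  shows "p = 0"
proof -
  define u :: "'k alg_closure poly" where "u = Polynomial.monom 1 n - 1"
  have n0: "n \<noteq> 0"
    using n by (metis of_nat_0)
  have deg_u: "Polynomial.degree u = n"
  proof (rule antisym)
    show "Polynomial.degree u \<le> n"
      unfolding u_def by (intro degree_diff_le) (auto simp: degree_monom_le)
    show "n \<le> Polynomial.degree u"
      by (rule le_degree) (use n0 in \<open>simp add: u_def coeff_1\<close>)
  qed
  have "of_nat n \<noteq> (0 :: 'k alg_closure)"
    using n by (metis to_ac_eq_0_iff to_ac_of_nat)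
  then have "poly (pderiv u) x \<noteq> 0" if "poly u x = 0" for x
    using that n0 by (auto simp: u_def poly_monom pderiv_diff pderiv_monom power_0_left)
  then have "u dvd map_poly to_ac p"
    using zero deg_u n0
    by (intro poly_dvd_if_simple_roots) (auto simp: u_def poly_monom ac_eval_def)
  then have "map_poly to_ac p = 0"
    using deg deg_u dvd_imp_degree_le[of u "map_poly to_ac p"] by (force simp: degree_map_poly)
  then show ?thesis
    by (simp add: map_poly_eq_0_iff)
qed

text \<open>
  A common root of the two factors would be a root of the derivative \<open>n x\<^sup>n\<^sup>-\<^sup>1\<close> as well.  This
  replaces every argument by coprimality of the irreducible factors below.
\<close>

lemma no_common_root_if_factors_unity:
  fixes g h :: "'k :: field poly"
  assumes n: "of_nat n \<noteq> (0 :: 'k)" and gh: "Polynomial.monom 1 n - 1 = g * h"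
    and "ac_eval g x = 0"
  shows "ac_eval h x \<noteq> 0"
proof
  assume "ac_eval h x = 0"
  have "Polynomial.monom (of_nat n) (n - 1) = pderiv g * h + g * pderiv h"
    using arg_cong[OF gh, of pderiv] by (simp add: pderiv_diff pderiv_monom pderiv_mult algebra_simps)
  then have "ac_eval (Polynomial.monom (of_nat n) (n - 1)) x = 0"
    using \<open>ac_eval h x = 0\<close> assms(3) by (simp add: ac_eval_simps)
  then have "x ^ (n - 1) = 0"
    using n by (metis ac_eval_monom mult_eq_0_iff to_ac_eq_0_iff)
  moreover have "x ^ n = 1"
    using arg_cong[OF gh, of "\<lambda>p. ac_eval p x"] assms(3) by (simp add: ac_eval_simps)
  moreover have "n \<noteq> 0"
    using n by (metis of_nat_0)
  ultimately show False
    by (auto simp: zero_power)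
qed

text \<open>
  The first factor of \<open>e\<^sub>g\<close>, which involves the reciprocal polynomial twice, is \<open>deg(g) g - x g'\<close>.
  In this form only \<open>- x g'\<close> survives at a root of \<open>g\<close>.
\<close>

lemma rev_pderiv_reflect_poly:
  "rev_poly (Polynomial.degree g - 1) (pderiv (reflect_poly g)) =
     Polynomial.smult (of_nat (Polynomial.degree g)) g - Polynomial.monom 1 1 * pderiv g"
  (is "rev_poly (?d - 1) ?h = _")
proof (rule poly_eqI)
  fix k
  have deg: "Polynomial.degree ?h \<le> ?d - 1"
    using degree_pderiv_le[of "reflect_poly g"] degree_reflect_poly_le[of g] by linarith
  have flip: "?d - 1 - i = k \<longleftrightarrow> k \<le> ?d - 1 \<and> i = ?d - 1 - k" if "i \<le> ?d - 1" for i
    using that by linarith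
  have "Polynomial.coeff (rev_poly (?d - 1) ?h) k
      = (\<Sum>i\<le>Polynomial.degree ?h. if ?d - 1 - i = k then Polynomial.coeff ?h i else 0)"
    by (simp add: rev_poly_def coeff_sum)
  also have "\<dots> = (\<Sum>i\<le>?d - 1. if ?d - 1 - i = k then Polynomial.coeff ?h i else 0)"
    by (rule sum.mono_neutral_left) (use deg in \<open>auto simp: coeff_eq_0\<close>)
  also have "\<dots> = (\<Sum>i\<le>?d - 1. if i = ?d - 1 - k then (if k \<le> ?d - 1 then Polynomial.coeff ?h i else 0) else 0)"
    using flip by (intro sum.cong) auto
  also have "\<dots> = (if k \<le> ?d - 1 then Polynomial.coeff ?h (?d - 1 - k) else 0)"
    by (simp add: sum.delta)
  also have "\<dots> = of_nat ?d * Polynomial.coeff g k - of_nat k * Polynomial.coeff g k"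
  proof (cases "k < ?d")
    case True
    then have "?d - Suc (?d - 1 - k) = k" "Suc (?d - 1 - k) = ?d - k"
      by auto
    then show ?thesis
      using True by (auto simp: coeff_pderiv coeff_reflect_poly of_nat_diff algebra_simps)
  next
    case False
    then show ?thesis
      by (cases "k = ?d") (auto simp: coeff_pderiv coeff_reflect_poly coeff_eq_0)
  qed
  finally show "Polynomial.coeff (rev_poly (?d - 1) ?h) k =
      Polynomial.coeff (Polynomial.smult (of_nat ?d) g - Polynomial.monom 1 1 * pderiv g) k"
    by (cases k) (simp_all add: coeff_monom_mult coeff_pderiv)
qed

text \<open>
  Write \<open>x\<^sup>n - 1 = g h\<close>.  Where \<open>g\<close> does not vanish, \<open>h\<close> does.  At a root \<open>\<beta>\<close> of \<open>g\<close> the value is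
  \<open>\<beta> g'(\<beta>) h(\<beta>) / n\<close>, and differentiating \<open>x\<^sup>n - 1 = g h\<close> gives \<open>g'(\<beta>) h(\<beta>) = n \<beta>\<^sup>n\<^sup>-\<^sup>1\<close>.
\<close>

lemma ac_eval_e_poly:
  fixes g :: "'k :: field poly"
  assumes n: "of_nat n \<noteq> (0 :: 'k)" and g: "g dvd Polynomial.monom 1 n - 1" and x: "x ^ n = 1"
  shows "ac_eval (e_poly n g) x = (if ac_eval g x = 0 then 1 else 0)"
proof -
  obtain h where h: "Polynomial.monom 1 n - 1 = g * h"
    using g by (auto simp: dvd_def)
  have n0: "n \<noteq> 0"
    using n by (metis of_nat_0)
  have gh: "ac_eval g x * ac_eval h x = 0"
    using arg_cong[OF h, of "\<lambda>p. ac_eval p x"] x by (simp add: ac_eval_simps)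
  have "g \<noteq> 0"
  proof
    assume "g = 0"
    then have "Polynomial.coeff (Polynomial.monom 1 n - 1 :: 'k poly) n = 0"
      using h by simp
    then show False
      using n0 by (simp add: coeff_1)
  qed
  then have "(Polynomial.monom 1 n - 1) div g = h"
    by (simp add: h)
  then have e: "e_poly n g = - Polynomial.smult (inverse (of_nat n))
      (Polynomial.smult (of_nat (Polynomial.degree g)) g - Polynomial.monom 1 1 * pderiv g) * h"
    by (simp only: e_poly_def rev_pderiv_reflect_poly)
  have deriv: "ac_eval (pderiv g) x * ac_eval h x = of_nat n * x ^ (n - 1)" if "ac_eval g x = 0"
  proof -
    have "Polynomial.monom (of_nat n) (n - 1) = pderiv g * h + g * pderiv h"
      using arg_cong[OF h, of pderiv] by (simp add: pderiv_diff pderiv_monom pderiv_mult algebra_simps)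
    from arg_cong[OF this, of "\<lambda>p. ac_eval p x"] show ?thesis
      using that by (simp add: ac_eval_simps)
  qed
  show ?thesis
  proof (cases "ac_eval g x = 0")
    case True
    have nz: "of_nat n \<noteq> (0 :: 'k alg_closure)"
      using n by (metis to_ac_eq_0_iff to_ac_of_nat)
    have "ac_eval (e_poly n g) x = inverse (of_nat n) * x * (ac_eval (pderiv g) x * ac_eval h x)"
      by (simp add: e ac_eval_simps True)
    also have "\<dots> = x * x ^ (n - 1)"
      using nz by (simp add: deriv[OF True])
    also have "\<dots> = 1"
      using x n0 by (metis power_eq_if)
    finally show ?thesis
      using True by simp
  next
    case False
    then show ?thesis
      using gh by (simp add: e ac_eval_simps)
  qed
qed

section \<open>Two by two matrices\<close>

lemma mat2_nth [simp]:
  "mat2 a b c d $ 1 $ 1 = a" "mat2 a b c d $ 1 $ 2 = b"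
  "mat2 a b c d $ 2 $ 1 = c" "mat2 a b c d $ 2 $ 2 = d"
  by (simp_all add: mat2_def vector_2)

lemma mat2_surj: "\<exists>a b c d. Y = mat2 a b c d"
  by (rule exI[of _ "Y $ 1 $ 1"], rule exI[of _ "Y $ 1 $ 2"], rule exI[of _ "Y $ 2 $ 1"],
      rule exI[of _ "Y $ 2 $ 2"]) (simp add: vec_eq_iff forall_2)

lemma mat2_eq_iff: "mat2 a b c d = mat2 a' b' c' d' \<longleftrightarrow> a = a' \<and> b = b' \<and> c = c' \<and> d = d'"
  by (auto simp: vec_eq_iff forall_2)

lemma mat2_add: "mat2 a b c d + mat2 a' b' c' d' = mat2 (a + a') (b + b') (c + c') (d + d')"
  by (simp add: vec_eq_iff forall_2)

lemma mat2_uminus: "- mat2 a b c d = mat2 (- a) (- b) (- c) (- d)"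
  by (simp add: vec_eq_iff forall_2)

lemma mat2_0: "0 = mat2 0 0 0 0"
  by (simp add: vec_eq_iff forall_2)

lemma mat2_1: "mat 1 = mat2 1 0 0 1"
  by (simp add: vec_eq_iff forall_2 mat_def)

lemma mat2_mult: "mat2 a b c d ** mat2 a' b' c' d' =
    mat2 (a * a' + b * c') (a * b' + b * d') (c * a' + d * c') (c * b' + d * d')"
  by (simp add: vec_eq_iff forall_2 matrix_matrix_mult_def sum_2)

lemma mat2_scalar_mult: "mat2 t 0 0 t ** Y = (\<chi> i j. t * Y $ i $ j)"
  by (simp add: vec_eq_iff forall_2 matrix_matrix_mult_def sum_2)

lemmas mat2_simps = mat2_add mat2_uminus mat2_mult mat2_eq_iff

lemma matrix_inv_Zmat:
  fixes x :: "'c :: field"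
  assumes "inverse x \<noteq> x"
  shows "matrix_inv (Zmat x) ** Zmat x = mat 1" "Zmat x ** matrix_inv (Zmat x) = mat 1"
proof -
  define d where "d = x - inverse x"
  have d: "d \<noteq> 0"
    using assms by (simp add: d_def)
  \<comment> \<open>the adjugate of Z divided by its determinant x - 1/x\<close>
  define W where "W = mat2 (- inverse x / d) (x / d) (- 1 / d) (1 / d)"
  have "W ** Zmat x = mat 1 \<and> Zmat x ** W = mat 1"
    using d by (simp add: W_def Zmat_def mat2_1 mat2_simps) (simp add: field_simps, simp add: d_def field_simps)
  then have "\<exists>W. Zmat x ** W = mat 1 \<and> W ** Zmat x = mat 1"
    by blast
  from someI_ex[OF this]
  show "matrix_inv (Zmat x) ** Zmat x = mat 1" "Zmat x ** matrix_inv (Zmat x) = mat 1"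
    by (simp_all add: matrix_inv_def)
qed

text \<open>
  In this form, conjugates by \<open>Z\<close> are computed without writing down the inverse of \<open>Z\<close>.
\<close>

lemma sig_eq_iff:
  fixes x :: "'c :: field"
  assumes "inverse x \<noteq> x"
  shows "sig x U = Y \<longleftrightarrow> U ** Zmat x = Zmat x ** Y"
proof
  show "U ** Zmat x = Zmat x ** Y" if "sig x U = Y"
  proof -
    have "Zmat x ** Y = (Zmat x ** matrix_inv (Zmat x)) ** U ** Zmat x"
      unfolding that[symmetric] sig_def by (simp only: matrix_mul_assoc)
    then show ?thesis
      by (simp add: matrix_inv_Zmat[OF assms])
  qed
  show "sig x U = Y" if "U ** Zmat x = Zmat x ** Y"
  proof -
    have "sig x U = matrix_inv (Zmat x) ** (Zmat x ** Y)"
      unfolding that[symmetric] sig_def by (simp only: matrix_mul_assoc)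
    then show ?thesis
      by (simp only: matrix_mul_assoc matrix_inv_Zmat[OF assms] matrix_mul_lid)
  qed
qed

lemma matrix_add_rdistrib:
  fixes A B :: "'c :: semiring_1 ^ 'm ^ 'l" and C :: "'c ^ 'p ^ 'm"
  shows "(A + B) ** C = A ** C + B ** C"
  by (simp add: vec_eq_iff matrix_matrix_mult_def distrib_right sum.distrib)

lemma sig_add: "sig x (U + Y) = sig x U + sig x Y"
  by (simp add: sig_def matrix_add_ldistrib matrix_add_rdistrib)

lemma sig_mult:
  fixes x :: "'c :: field"
  assumes "inverse x \<noteq> x"
  shows "sig x (U ** Y) = sig x U ** sig x Y"
proof -
  have "sig x U ** sig x Y = matrix_inv (Zmat x) ** U ** (Zmat x ** matrix_inv (Zmat x)) ** Y ** Zmat x"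
    by (simp only: sig_def matrix_mul_assoc)
  then show ?thesis
    by (simp add: matrix_inv_Zmat[OF assms] sig_def matrix_mul_assoc)
qed

lemma sig_scalar:
  fixes x :: "'c :: field"
  assumes "inverse x \<noteq> x"
  shows "sig x (mat2 t 0 0 t) = mat2 t 0 0 t"
  by (simp add: sig_eq_iff[OF assms] Zmat_def mat2_simps)

section \<open>Homomorphisms on group algebras\<close>

lemma poly_mapping_single_induct [case_names single add]:
  fixes u :: "'g \<Rightarrow>\<^sub>0 'k :: comm_monoid_add"
  assumes single: "\<And>g c. P (Poly_Mapping.single g c)"
    and add: "\<And>u v. P u \<Longrightarrow> P v \<Longrightarrow> P (u + v)"
  shows "P u"
proof -
  have "u = (\<Sum>g\<in>Poly_Mapping.keys u. Poly_Mapping.single g (Poly_Mapping.lookup u g))"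
    by (rule poly_mapping_eqI) (simp add: lookup_sum lookup_single when_def in_keys_iff)
  moreover have "P (\<Sum>g\<in>S. Poly_Mapping.single g (Poly_Mapping.lookup u g))" if "finite S" for S
    using that
  proof induction
    case empty
    then show ?case
      using single[of undefined 0] by simp
  next
    case (insert g S)
    then show ?case
      by (simp add: add single)
  qed
  ultimately show ?thesis
    by (metis finite_keys)
qed

text \<open>
  Convolution is bilinear, so multiplicativity only has to be checked on monomials.  The product
  \<open>star\<close> is a parameter because \<^const>\<open>times\<close> on matrices is the entrywise product.
\<close>

lemma group_algebra_hom_mult:
  fixes \<Phi> :: "('g :: monoid_add \<Rightarrow>\<^sub>0 'k :: semiring_1) \<Rightarrow> 'b :: plus"
  assumes add: "\<And>u v. \<Phi> (u + v) = \<Phi> u + \<Phi> v"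
    and distrib: "\<And>x y z. star (x + y) z = star x z + star y z" "\<And>x y z. star x (y + z) = star x y + star x z"
    and single: "\<And>g h c d. \<Phi> (Poly_Mapping.single (g + h) (c * d)) =
      star (\<Phi> (Poly_Mapping.single g c)) (\<Phi> (Poly_Mapping.single h d))"
  shows "\<Phi> (u * v) = star (\<Phi> u) (\<Phi> v)"
proof (induction u rule: poly_mapping_single_induct)
  case (single g c)
  show ?case
    by (induction v rule: poly_mapping_single_induct)
      (simp_all add: mult_single assms(4) distrib_left add distrib)
next
  case (add u u')
  then show ?case
    by (simp add: distrib_right assms)
qed

text \<open>
  The group algebra is generated by \<open>a\<close>, \<open>b\<close> and the scalars.
\<close>

lemma dih_alg_induct [case_names scal gen_a gen_b add mult]:
  fixes u :: "'n :: nontriv dih \<Rightarrow>\<^sub>0 'k :: field"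
  assumes scal: "\<And>c. P (scal c)" and a: "P gen_a" and b: "P gen_b"
    and add: "\<And>u v. P u \<Longrightarrow> P v \<Longrightarrow> P (u + v)" and mult: "\<And>u v. P u \<Longrightarrow> P v \<Longrightarrow> P (u * v)"
  shows "P u"
proof -
  have zero: "P 0"
    using scal[of 0] by (simp add: scal_def)
  have power: "P (gen_a ^ k)" for k
  proof (induction k)
    case 0
    then show ?case
      using scal[of 1] by (simp add: scal_def)
  qed (simp add: mult a)
  have sum: "P (\<Sum>i\<in>S. w i)" if "finite S" "\<And>i. P (w i)" for S and w :: "nat \<Rightarrow> _"
    using that by induction (simp_all add: zero add)
  have "P (aeval p gen_a)" for p
    unfolding aeval_def by (intro sum mult scal power) simp
  then show ?thesis
    using dih_alg_decomp(3)[of u] by (metis add mult b)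
qed

lemma mod_ring_as_of_nat:
  obtains k where "(m :: 'n :: nontriv mod_ring) = of_nat k" "k < CARD('n)"
  using UNIV_mod_ring[where 'n = 'n] by (metis UNIV_I imageE lessThan_iff)

lemma of_nat_mod_card: "(of_nat (k mod CARD('n)) :: 'n :: nontriv mod_ring) = of_nat k"
proof -
  have "(of_nat k :: 'n mod_ring) = of_nat (CARD('n) * (k div CARD('n)) + k mod CARD('n))"
    by simp
  also have "\<dots> = of_nat (k mod CARD('n))"
    by (simp only: of_nat_add of_nat_mult of_nat_card_eq_0) simp
  finally show ?thesis
    by simp
qed

lemma uminus_of_nat_mod_ring:
  "k \<le> CARD('n) \<Longrightarrow> - (of_nat k :: 'n :: nontriv mod_ring) = of_nat (CARD('n) - k)"
  by (simp add: of_nat_diff)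

lemma P_part_single: "k < CARD('n) \<Longrightarrow>
    P_part (Poly_Mapping.single (Dih i (of_nat k) :: 'n :: nontriv dih) c) =
      (if i = 0 then Polynomial.monom c k else 0)"
  using inj_on_of_nat_mod_ring[where 'n = 'n]
  by (intro poly_eqI) (auto simp: coeff_P_part lookup_single when_def inj_on_def)

lemma Q_part_single: "k < CARD('n) \<Longrightarrow>
    Q_part (Poly_Mapping.single (Dih i (of_nat k) :: 'n :: nontriv dih) c) =
      (if i = 0 then 0 else Polynomial.monom c k)"
  using inj_on_of_nat_mod_ring[where 'n = 'n]
  by (cases i) (auto intro!: poly_eqI simp: coeff_Q_part lookup_single when_def inj_on_def)

lemma P_part_add: "P_part (u + v) = P_part u + P_part v"
  by (rule poly_eqI) (simp add: coeff_P_part lookup_add)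

lemma Q_part_add: "Q_part (u + v) = Q_part u + Q_part v"
  by (rule poly_eqI) (simp add: coeff_Q_part lookup_add)

lemma scal_add: "scal (c + d) = scal c + scal d"
  by (simp add: scal_def single_add)

lemma power_mod_exponent:
  fixes x :: "'c :: monoid_mult"
  assumes "x ^ n = 1"
  shows "x ^ (k mod n) = x ^ k"
proof -
  have "x ^ k = x ^ (n * (k div n) + k mod n)"
    by simp
  also have "\<dots> = x ^ (k mod n)"
    by (simp only: power_add power_mult assms) simp
  finally show ?thesis
    by simp
qed

text \<open>
  The exponents of \<open>a\<close> live in \<open>\<int>/n\<close> and the inverse of \<open>a\<^sup>k\<close> is represented by \<open>a\<^sup>n\<^sup>-\<^sup>k\<close>; these are
  the corresponding powers of an \<open>n\<close>-th root of unity.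
\<close>

lemma power_diff_exponent:
  fixes x :: "'c :: field"
  assumes "x ^ n = 1" "k \<le> n"
  shows "x ^ (n - k) = inverse x ^ k" "inverse x ^ (n - k) = x ^ k"
proof -
  have x: "x \<noteq> 0" if "k \<noteq> 0"
    using assms that by (auto simp: power_0_left)
  show *: "x ^ (n - k) = inverse x ^ k"
    by (cases "k = 0") (use assms x in \<open>auto simp: power_diff field_simps\<close>)
  show "inverse x ^ (n - k) = x ^ k"
    unfolding power_inverse * by simp
qed

section \<open>The two-dimensional representations \<open>\<tau>\<close>\<close>

lemma tau_add: "tau x (u + v) = tau x u + tau x v"
  by (simp add: tau_def P_part_add Q_part_add ac_eval_add mat2_add)

text \<open>
  The range restriction on the exponents in \<open>P\<close> and \<open>Q\<close> disappears at an \<open>n\<close>-th root of unity, where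
  the powers have period \<open>n\<close>.
\<close>

lemma tau_single:
  fixes x :: "'k :: field alg_closure"
  assumes x: "x ^ CARD('n :: nontriv) = 1"
  shows "tau x (Poly_Mapping.single (Dih 0 (of_nat k) :: 'n dih) c) =
           mat2 (to_ac c * x ^ k) 0 0 (to_ac c * inverse x ^ k)"
    and "tau x (Poly_Mapping.single (Dih 1 (of_nat k) :: 'n dih) c) =
           mat2 0 (to_ac c * inverse x ^ k) (to_ac c * x ^ k) 0"
proof -
  have inv: "inverse x ^ CARD('n) = 1"
    using x by (simp add: power_inverse)
  have less: "k mod CARD('n) < CARD('n)"
    by simp
  note * = P_part_single[OF less] Q_part_single[OF less] power_mod_exponent[OF x] power_mod_exponent[OF inv]
  show "tau x (Poly_Mapping.single (Dih 0 (of_nat k) :: 'n dih) c) =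
           mat2 (to_ac c * x ^ k) 0 0 (to_ac c * inverse x ^ k)"
    and "tau x (Poly_Mapping.single (Dih 1 (of_nat k) :: 'n dih) c) =
           mat2 0 (to_ac c * inverse x ^ k) (to_ac c * x ^ k) 0"
    unfolding of_nat_mod_card[of k, symmetric]
    by (simp_all add: tau_def * ac_eval_simps)
qed

text \<open>
  On monomials this says that \<open>a \<mapsto> diag(x, x\<^sup>-\<^sup>1)\<close> and \<open>b \<mapsto> (0 1; 1 0)\<close> define a representation of the
  dihedral group.
\<close>

lemma tau_mult:
  fixes x :: "'k :: field alg_closure" and u v :: "'n :: nontriv dih \<Rightarrow>\<^sub>0 'k"
  assumes x: "x ^ CARD('n) = 1"
  shows "tau x (u * v) = tau x u ** tau x v"
proof (rule group_algebra_hom_mult)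
  fix g h :: "'n dih" and c d :: 'k
  obtain i k' j l' where g: "g = Dih i k'" and h: "h = Dih j l'"
    by (metis dih.exhaust)
  obtain k where k: "k' = of_nat k" "k < CARD('n)"
    by (rule mod_ring_as_of_nat)
  obtain l where l: "l' = of_nat l" "l < CARD('n)"
    by (rule mod_ring_as_of_nat)
  have plus: "k' + l' = of_nat (k + l)" and minus: "- k' + l' = of_nat ((CARD('n) - k) + l)"
    using k l uminus_of_nat_mod_ring[where 'n = 'n, of k] by (simp_all only: of_nat_add less_imp_le)
  note pow = power_diff_exponent[OF x less_imp_le[OF k(2)]]
  show "tau x (Poly_Mapping.single (g + h) (c * d)) =
      tau x (Poly_Mapping.single g c) ** tau x (Poly_Mapping.single h d)"
  proof (cases "j = 0")
    case True
    then have "g + h = Dih i (of_nat (k + l))"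
      unfolding g h plus_dih.simps plus[symmetric] by simp
    then show ?thesis
      using True unfolding g h k(1) l(1)
      by (cases i) (simp_all add: tau_single[OF x] power_add mat2_mult mat2_eq_iff del: of_nat_add)
  next
    case False
    then have "g + h = Dih (i + 1) (of_nat ((CARD('n) - k) + l))" "j = 1"
      unfolding g h plus_dih.simps minus[symmetric] by (simp_all add: bit_not_zero_iff)
    then show ?thesis
      unfolding g h k(1) l(1)
      by (cases i) (simp_all add: tau_single[OF x] power_add pow mat2_mult mat2_eq_iff del: of_nat_add)
  qed
qed (simp_all add: tau_add matrix_add_ldistrib matrix_add_rdistrib)

lemma parts_scal:
  "P_part (scal c :: 'n :: nontriv dih \<Rightarrow>\<^sub>0 'k :: field) = [:c:]"
  "Q_part (scal c :: 'n dih \<Rightarrow>\<^sub>0 'k) = 0"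
proof -
  have scal: "(scal c :: 'n dih \<Rightarrow>\<^sub>0 'k) = Poly_Mapping.single (Dih 0 (of_nat 0)) c"
    by (simp add: scal_def zero_dih_def)
  show "P_part (scal c :: 'n dih \<Rightarrow>\<^sub>0 'k) = [:c:]" "Q_part (scal c :: 'n dih \<Rightarrow>\<^sub>0 'k) = 0"
    unfolding scal by (subst P_part_single Q_part_single; simp add: monom_0)+
qed

lemma tau_scal: "tau x (scal c :: 'n :: nontriv dih \<Rightarrow>\<^sub>0 'k :: field) = mat2 (to_ac c) 0 0 (to_ac c)"
  by (simp add: tau_def parts_scal ac_eval_simps)

lemma tau_gen_a:
  assumes "x ^ CARD('n :: nontriv) = 1"
  shows "tau x (gen_a :: 'n dih \<Rightarrow>\<^sub>0 'k :: field) = mat2 x 0 0 (inverse x)"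
  using tau_single(1)[OF assms, of 1 1] by simp

lemma tau_gen_b:
  assumes "x ^ CARD('n :: nontriv) = 1"
  shows "tau x (gen_b :: 'n dih \<Rightarrow>\<^sub>0 'k :: field) = mat2 0 1 1 0"
  using tau_single(2)[OF assms, of 0 1] by simp

lemma tau_gen_a_inv:
  assumes "x ^ CARD('n :: nontriv) = 1"
  shows "tau x (gen_a_inv :: 'n dih \<Rightarrow>\<^sub>0 'k :: field) = mat2 (inverse x) 0 0 x"
proof -
  have le: "1 \<le> CARD('n)"
    by (simp add: Suc_leI)
  have "(- 1 :: 'n mod_ring) = of_nat (CARD('n) - 1)"
    using uminus_of_nat_mod_ring[OF le] by (simp only: of_nat_1)
  then show ?thesis
    using tau_single(1)[OF assms, of "CARD('n) - 1" 1] power_diff_exponent[OF assms le] by simp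
qed

lemma tau_0: "tau x 0 = 0"
  using tau_add[of x 0 0] by simp

lemma tau_uminus: "tau x (- u) = - tau x u"
  using tau_add[of x u "- u"] by (simp add: tau_0 eq_neg_iff_add_eq_0 add.commute)

lemma tau_sum: "tau x (\<Sum>i\<in>I. u i) = (\<Sum>i\<in>I. tau x (u i))"
  by (induction I rule: infinite_finite_induct) (simp_all add: tau_0 tau_add)

text \<open>
  Every argument of a polynomial in the formulas for \<open>\<epsilon>\<^sub>j\<close> is \<open>a\<close> or \<open>a + a\<^sup>-\<^sup>1\<close>, and both become
  diagonal.
\<close>

lemma tau_aeval:
  fixes v :: "'n :: nontriv dih \<Rightarrow>\<^sub>0 'k :: field"
  assumes x: "x ^ CARD('n) = 1" and v: "tau x v = mat2 t 0 0 t'"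
  shows "tau x (aeval p v) = mat2 (ac_eval p t) 0 0 (ac_eval p t')"
proof -
  have power: "tau x (v ^ k) = mat2 (t ^ k) 0 0 (t' ^ k)" for k
  proof (induction k)
    case 0
    then show ?case
      using tau_scal[of x 1] by (simp add: scal_def)
  qed (simp add: tau_mult[OF x] v mat2_mult)
  have sum: "(\<Sum>i\<in>I. mat2 (a i) 0 0 (b i)) = mat2 (\<Sum>i\<in>I. a i) 0 0 (\<Sum>i\<in>I. b i)"
    for I :: "nat set" and a b :: "nat \<Rightarrow> 'k alg_closure"
    by (induction I rule: infinite_finite_induct) (simp_all add: mat2_0 mat2_add)
  show ?thesis
    unfolding ac_eval_sum[OF lessI] aeval_def lessThan_Suc_atMost
    by (simp add: tau_sum tau_mult[OF x] power tau_scal mat2_mult sum)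
qed

section \<open>The maps \<open>\<gamma>\<close> onto the group algebra of order two\<close>

definition gam_sign :: "nat \<Rightarrow> 'k :: field" where
  "gam_sign j = (if j = 1 then 1 else - 1)"

lemma gam_alt: "gam j u = scal (poly (P_part u) (gam_sign j)) + scal (poly (Q_part u) (gam_sign j)) * gen_h"
  by (simp add: gam_def gam_sign_def Let_def)

lemma gam_add: "gam j (u + v) = gam j u + gam j v"
  by (simp add: gam_alt P_part_add Q_part_add scal_add distrib_right)

lemma gam_single:
  fixes c :: "'k :: field"
  assumes "gam_sign j ^ CARD('n :: nontriv) = (1 :: 'k)"
  shows "gam j (Poly_Mapping.single (Dih i (of_nat k) :: 'n dih) c) =
    Poly_Mapping.single i (c * gam_sign j ^ k)"
proof -
  have less: "k mod CARD('n) < CARD('n)"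
    by simp
  show ?thesis
    unfolding of_nat_mod_card[of k, symmetric] gam_alt P_part_single[OF less] Q_part_single[OF less]
    by (cases i) (simp_all add: poly_monom power_mod_exponent[OF assms] scal_def mult_single)
qed

text \<open>
  Conjugation by \<open>b\<close> inverts \<open>a\<close>, and a sign is its own inverse; hence evaluating \<open>a\<close> at a sign that
  is an \<open>n\<close>-th root of unity is compatible with the group law.
\<close>

lemma gam_mult:
  fixes u v :: "'n :: nontriv dih \<Rightarrow>\<^sub>0 'k :: field"
  assumes x: "gam_sign j ^ CARD('n) = (1 :: 'k)"
  shows "gam j (u * v) = gam j u * gam j v"
proof (rule group_algebra_hom_mult)
  fix g h :: "'n dih" and c d :: 'k
  obtain i k' i' l' where g: "g = Dih i k'" and h: "h = Dih i' l'"
    by (metis dih.exhaust)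
  obtain k where k: "k' = of_nat k" "k < CARD('n)"
    by (rule mod_ring_as_of_nat)
  obtain l where l: "l' = of_nat l" "l < CARD('n)"
    by (rule mod_ring_as_of_nat)
  have plus: "k' + l' = of_nat (k + l)" and minus: "- k' + l' = of_nat ((CARD('n) - k) + l)"
    using k l uminus_of_nat_mod_ring[where 'n = 'n, of k] by (simp_all only: of_nat_add less_imp_le)
  have "inverse (gam_sign j) = (gam_sign j :: 'k)"
    by (simp add: gam_sign_def)
  then have pow: "(gam_sign j :: 'k) ^ (CARD('n) - k) = gam_sign j ^ k"
    using power_diff_exponent(1)[OF x less_imp_le[OF k(2)]] by simp
  have "g + h = Dih (i + i') (of_nat ((if i' = 0 then k else CARD('n) - k) + l))"
    unfolding g h plus_dih.simps by (simp only: plus minus split: if_split) blast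
  then have "gam j (Poly_Mapping.single (g + h) (c * d)) =
      Poly_Mapping.single (i + i') (c * d * gam_sign j ^ (k + l))"
    using gam_single[OF x, of "i + i'" "(if i' = 0 then k else CARD('n) - k) + l" "c * d"]
    by (simp only: power_add if_distrib[of "(^) _"] pow if_cancel)
  then show "gam j (Poly_Mapping.single (g + h) (c * d)) =
      gam j (Poly_Mapping.single g c) * gam j (Poly_Mapping.single h d)"
    unfolding g h k(1) l(1) gam_single[OF x] mult_single by (simp only: power_add mult_ac)
qed (simp_all add: gam_add distrib_left distrib_right)

lemma gam_scal: "gam j (scal c :: 'n :: nontriv dih \<Rightarrow>\<^sub>0 'k :: field) = scal c"
  by (simp add: gam_alt parts_scal) (simp add: scal_def)

lemma gam_gen_b:
  assumes "gam_sign j ^ CARD('n :: nontriv) = (1 :: 'k :: field)"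
  shows "gam j (gen_b :: 'n dih \<Rightarrow>\<^sub>0 'k) = gen_h"
  using gam_single[OF assms, of 1 0 1] by simp

lemma gam_aeval:
  assumes x: "gam_sign j ^ CARD('n :: nontriv) = (1 :: 'k :: field)"
  shows "gam j (aeval p gen_a :: 'n dih \<Rightarrow>\<^sub>0 'k) = scal (poly p (gam_sign j))"
proof -
  have gam_sum: "gam j (\<Sum>i\<in>I. u i) = (\<Sum>i\<in>I. gam j (u i))"
    for I :: "nat set" and u :: "nat \<Rightarrow> 'n dih \<Rightarrow>\<^sub>0 'k"
    using gam_add[of j 0 0]
    by (induction I rule: infinite_finite_induct) (simp_all add: gam_add)
  have scal_sum: "scal (\<Sum>i\<in>I. a i) = (\<Sum>i\<in>I. scal (a i) :: bit \<Rightarrow>\<^sub>0 'k)" for I :: "nat set" and a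
    by (induction I rule: infinite_finite_induct) (simp_all add: scal_add, simp_all add: scal_def)
  have a: "gam j (gen_a ^ k :: 'n dih \<Rightarrow>\<^sub>0 'k) = scal (gam_sign j ^ k)" for k
    by (simp add: gen_a_power gam_single[OF x] scal_def)
  show ?thesis
    unfolding aeval_def poly_altdef
    by (simp add: gam_sum gam_mult[OF x] gam_scal a scal_sum) (simp add: scal_def mult_single)
qed

section \<open>Simple extensions and matrices over them\<close>

lemma to_ac_in_adjoin: "to_ac c \<in> adjoin x"
  unfolding adjoin_def by (metis ac_eval_const rangeI)

lemma self_in_adjoin: "x \<in> adjoin x"
  unfolding adjoin_def by (rule range_eqI[of _ _ "[:0, 1:]"]) (simp add: ac_eval_simps)

lemma adjoin_add: "y \<in> adjoin x \<Longrightarrow> z \<in> adjoin x \<Longrightarrow> y + z \<in> adjoin x"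
  unfolding adjoin_def by (force simp: ac_eval_add[symmetric])

lemma adjoin_mult: "y \<in> adjoin x \<Longrightarrow> z \<in> adjoin x \<Longrightarrow> y * z \<in> adjoin x"
  unfolding adjoin_def by (force simp: ac_eval_mult[symmetric])

lemma adjoin_consts: "0 \<in> adjoin x" "1 \<in> adjoin x"
  using to_ac_in_adjoin[of 0 x] to_ac_in_adjoin[of 1 x] by simp_all

lemma adjoin_uminus: "y \<in> adjoin x \<Longrightarrow> - y \<in> adjoin x"
  using adjoin_mult[OF to_ac_in_adjoin[of "- 1"]] by force

lemma adjoin_power: "y \<in> adjoin x \<Longrightarrow> y ^ k \<in> adjoin x"
  by (induction k) (simp_all add: adjoin_consts adjoin_mult)

lemma ac_eval_in_adjoin:
  assumes "y \<in> adjoin x"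
  shows "ac_eval p y \<in> adjoin x"
  by (induction p) (simp_all add: ac_eval_simps adjoin_consts adjoin_add adjoin_mult to_ac_in_adjoin assms)

text \<open>
  The inverse of an \<open>n\<close>-th root of unity is its power with exponent \<open>n - 1\<close>, so each of the two is a
  polynomial expression in the other.
\<close>

lemma adjoin_inverse_unity_root:
  assumes x: "x ^ n = 1" and n: "n \<noteq> 0"
  shows "adjoin (inverse x) = adjoin x"
proof -
  have *: "adjoin z \<subseteq> adjoin (inverse z)" if "z ^ n = 1" for z :: "'a alg_closure"
  proof -
    have "inverse z ^ (n - 1) = z"
      using power_diff_exponent(2)[OF that, of 1] n by simp
    then have "z \<in> adjoin (inverse z)"
      using adjoin_power[OF self_in_adjoin[of "inverse z"]] by metis
    then show ?thesis
      using ac_eval_in_adjoin unfolding adjoin_def[of z] by blast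
  qed
  show ?thesis
    using *[OF x] *[of "inverse x"] x by (simp add: power_inverse subset_antisym)
qed

text \<open>
  A nonzero polynomial \<open>m\<close> of least degree with root \<open>x\<close> divides every polynomial with root \<open>x\<close>, by
  division with remainder.  It divides \<open>f\<close> in particular, and as \<open>f\<close> is irreducible, \<open>f\<close> and \<open>m\<close>
  are associates.
\<close>

lemma minimal_poly_dvd:
  fixes f p :: "'k :: field poly"
  assumes f: "Factorial_Ring.irreducible f" "ac_eval f x = 0" and p: "ac_eval p x = 0"
  shows "f dvd p"
proof -
  define V where "V m \<longleftrightarrow> m \<noteq> 0 \<and> ac_eval m x = 0" for m :: "'k poly"
  have "V f"
    using f by (auto simp: V_def)
  then obtain m where m: "V m" and least: "\<And>m'. V m' \<Longrightarrow> Polynomial.degree m \<le> Polynomial.degree m'"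
    by (metis ex_has_least_nat)
  have dvd: "m dvd p" if "ac_eval p x = 0" for p
  proof (rule ccontr)
    assume "\<not> m dvd p"
    then have nz: "p mod m \<noteq> 0"
      by (simp add: mod_eq_0_iff_dvd)
    have "ac_eval (p mod m) x = ac_eval (p - (p div m) * m) x"
      by (simp add: minus_div_mult_eq_mod)
    also have "\<dots> = 0"
      using that m by (simp add: ac_eval_simps V_def)
    finally have "V (p mod m)"
      using nz by (simp add: V_def)
    then show False
      using least[of "p mod m"] degree_mod_less[of m p] nz m by (auto simp: V_def)
  qed
  have not_unit: "\<not> m dvd 1"
  proof
    assume "m dvd 1"
    then obtain c where "1 = m * c"
      by (auto simp: dvd_def)
    from arg_cong[OF this, of "\<lambda>p. ac_eval p x"] show False
      using m by (simp add: ac_eval_simps V_def)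
  qed
  obtain c where c: "f = m * c"
    using dvd[OF f(2)] by (auto simp: dvd_def)
  then have "c dvd 1"
    using Factorial_Ring.irreducibleD[OF f(1) c] not_unit by blast
  then have "f dvd m"
    unfolding c by (simp add: mult_unit_dvd_iff)
  then show ?thesis
    using dvd[OF p] by (rule dvd_trans)
qed

lemma ac_eval_mrecip_eq_0_iff:
  assumes "g \<noteq> 0" "x \<noteq> 0"
  shows "ac_eval (mrecip g) x = 0 \<longleftrightarrow> ac_eval g (inverse x) = 0"
  using assms by (simp add: mrecip_def ac_eval_simps ac_eval_reflect_poly)

lemma in_carrier_mat_alg:
  "mat2 a b c d \<in> carrier (mat_alg K) \<longleftrightarrow> a \<in> K \<and> b \<in> K \<and> c \<in> K \<and> d \<in> K"
  by (auto simp: mat_alg_def forall_2)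

lemma mat_alg_adjoin_closed:
  assumes "U \<in> carrier (mat_alg (adjoin x))" "V \<in> carrier (mat_alg (adjoin x))"
  shows "U + V \<in> carrier (mat_alg (adjoin x))" "U ** V \<in> carrier (mat_alg (adjoin x))"
proof -
  obtain a b c d a' b' c' d' where "U = mat2 a b c d" "V = mat2 a' b' c' d'"
    by (metis mat2_surj)
  then show "U + V \<in> carrier (mat_alg (adjoin x))" "U ** V \<in> carrier (mat_alg (adjoin x))"
    using assms by (simp_all add: in_carrier_mat_alg mat2_simps adjoin_add adjoin_mult)
qed

lemma cyc2_decomp:
  "(v :: bit \<Rightarrow>\<^sub>0 'k :: field) = scal (Poly_Mapping.lookup v 0) + scal (Poly_Mapping.lookup v 1) * gen_h"
proof (rule poly_mapping_eqI)
  fix i :: bit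
  show "Poly_Mapping.lookup v i =
    Poly_Mapping.lookup (scal (Poly_Mapping.lookup v 0) + scal (Poly_Mapping.lookup v 1) * gen_h) i"
    by (cases i) (simp_all add: scal_single lookup_add lookup_single scal_def mult_single)
qed

lemma cyc2_eq_iff:
  "(scal a + scal b * gen_h :: bit \<Rightarrow>\<^sub>0 'k :: field) = scal c + scal d * gen_h \<longleftrightarrow> a = c \<and> b = d"
proof -
  have *: "Poly_Mapping.lookup (scal a + scal b * gen_h :: bit \<Rightarrow>\<^sub>0 'k) 0 = a"
    "Poly_Mapping.lookup (scal a + scal b * gen_h :: bit \<Rightarrow>\<^sub>0 'k) 1 = b" for a b
    by (simp_all add: scal_single lookup_add lookup_single scal_def mult_single)
  show ?thesis
    using *[of a b] *[of c d] by metis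
qed

lemma sig_inj:
  fixes x :: "'c :: field"
  assumes "inverse x \<noteq> x" and "sig x U = sig x V"
  shows "U = V"
proof -
  have "U ** Zmat x = V ** Zmat x"
    using sig_eq_iff[OF assms(1)] assms(2) by metis
  then have "U ** (Zmat x ** matrix_inv (Zmat x)) = V ** (Zmat x ** matrix_inv (Zmat x))"
    by (simp add: matrix_mul_assoc)
  then show ?thesis
    by (simp add: matrix_inv_Zmat[OF assms(1)])
qed

text \<open>
  The matrix on the left is \<open>\<tau>\<close> of the preimage of \<open>(m p; n q)\<close>, with \<open>D = (x\<^sup>2 - 1)\<^sup>-\<^sup>1\<close> and
  \<open>E = (y\<^sup>2 - 1)\<^sup>-\<^sup>1\<close> coming from the Bezout coefficients.  Conjugation by \<open>Z\<close> takes it to \<open>(m p; n q)\<close>.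
\<close>

lemma companion_identities:
  fixes x y D E m n p q :: "'c :: field"
  assumes xy: "x * y = 1" and D: "D * (x\<^sup>2 - 1) = 1" and E: "E * (y\<^sup>2 - 1) = 1"
  shows "mat2 (D * (- m + x * n - x * p + x\<^sup>2 * q)) (E * (- m + x * n - y * p + q))
              (D * (- m + y * n - x * p + q)) (E * (- m + y * n - y * p + y\<^sup>2 * q)) ** Zmat x
       = Zmat x ** mat2 m p n q"
proof -
  have y: "inverse x = y"
    using xy by (simp add: inverse_unique)
  have xy2: "x\<^sup>2 * y\<^sup>2 = 1"
    using xy by (simp flip: power_mult_distrib)
  have "E * (1 - x\<^sup>2) = E * (x\<^sup>2 * y\<^sup>2 - x\<^sup>2)"
    by (simp add: xy2)
  also have "\<dots> = x\<^sup>2 * (E * (y\<^sup>2 - 1))"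
    by (simp add: algebra_simps)
  finally have E1: "E * (1 - x\<^sup>2) = x\<^sup>2"
    by (simp add: E)
  have "E = E * (D * (x\<^sup>2 - 1))"
    by (simp add: D)
  also have "\<dots> = - (E * (1 - x\<^sup>2) * D)"
    by (simp add: algebra_simps)
  finally have E': "E = - (x\<^sup>2 * D)"
    by (simp add: E1)
  \<comment> \<open>As E = - x^2 D, every entry has the factor D; it cancels against the factor x^2 - 1
    of what remains.\<close>
  have cancel_D: "D * a * u + - (x\<^sup>2 * D) * b * v = c"
    if "a * u - x\<^sup>2 * (b * v) = (x\<^sup>2 - 1) * c" for a b c u v
  proof -
    have "D * a * u + - (x\<^sup>2 * D) * b * v = D * (a * u - x\<^sup>2 * (b * v))"
      by (simp add: algebra_simps)
    also have "\<dots> = D * (x\<^sup>2 - 1) * c"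
      by (simp only: that mult.assoc)
    also have "\<dots> = c"
      by (simp only: D mult_1)
    finally show ?thesis .
  qed
  have "x \<noteq> 0"
    using xy by auto
  then show ?thesis
    unfolding Zmat_def y mat2_mult mat2_eq_iff E'
    by (intro conjI cancel_D; simp add: y[symmetric] field_simps power2_eq_square)
qed

section \<open>The roots of the irreducible factors\<close>

locale unity_factorization =
  fixes n r s :: nat and f F G :: "nat \<Rightarrow> 'k :: field poly" and \<alpha> :: "nat \<Rightarrow> 'k alg_closure"
  assumes n_unit: "of_nat n \<noteq> (0 :: 'k)"
    and factorization:
      "Polynomial.monom 1 n - 1 = (\<Prod>j=1..r. f j) * (\<Prod>j=r+1..r+s. f j * mrecip (f j))"
    and irreducible: "\<And>j. j \<in> {1..r+s} \<Longrightarrow> Factorial_Ring.irreducible (f j)"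
    and zeta_le: "zeta n \<le> r"
    and f_1: "f 1 = [:-1, 1:]"
    and f_2: "even n \<Longrightarrow> f 2 = [:1, 1:]"
    and self_reciprocal: "\<And>j. 1 < j \<Longrightarrow> j \<le> r \<Longrightarrow> reflect_poly (f j) = f j"
    and root: "\<And>j. j \<in> {1..r+s} \<Longrightarrow> ac_eval (f j) (\<alpha> j) = 0"
    and bezout_F: "\<And>j. zeta n < j \<Longrightarrow> j \<le> r \<Longrightarrow> \<exists>F2. [:-1, 1:] * F j + f j * F2 = 1"
    and bezout_G: "\<And>j. zeta n < j \<Longrightarrow> j \<le> r \<Longrightarrow> \<exists>G2. [:1, 1:] * G j + f j * G2 = 1"
begin

abbreviation "I \<equiv> {1..r+s}"

abbreviation "A \<equiv> comp_alg n r \<alpha>"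

text \<open>
  The product of the irreducible factors that belong to the index \<open>j\<close>; its roots include \<open>\<alpha>\<^sub>j\<close> and
  \<open>\<alpha>\<^sub>j\<^sup>-\<^sup>1\<close> for every \<open>j\<close>.  With these products \<open>x\<^sup>n - 1\<close> has one factor for each component.
\<close>

definition block :: "nat \<Rightarrow> 'k poly" where
  "block j = (if j \<le> r then f j else f j * mrecip (f j))"

lemma n_nz: "n \<noteq> 0"
  using n_unit by (metis of_nat_0)

lemma zeta_pos: "1 \<le> zeta n"
  by (simp add: zeta_def)

lemma prod_block: "Polynomial.monom 1 n - 1 = (\<Prod>j\<in>I. block j)"
proof -
  have "(\<Prod>j\<in>I. block j) = (\<Prod>j\<in>{1..r}. block j) * (\<Prod>j\<in>{r+1..r+s}. block j)"
    by (subst prod.union_disjoint[symmetric]) (auto intro!: prod.cong)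
  then show ?thesis
    by (simp add: factorization block_def)
qed

lemma block_dvd: "j \<in> I \<Longrightarrow> block j dvd Polynomial.monom 1 n - 1"
  unfolding prod_block by (rule dvd_prodI) simp_all

lemma f_dvd: "j \<in> I \<Longrightarrow> f j dvd Polynomial.monom 1 n - 1"
  using block_dvd[of j] by (auto simp: block_def split: if_splits dest: dvd_mult_left)

lemma mrecip_dvd: "j \<in> I \<Longrightarrow> r < j \<Longrightarrow> mrecip (f j) dvd Polynomial.monom 1 n - 1"
  using block_dvd[of j] by (auto simp: block_def split: if_splits dest: dvd_mult_right)

lemma unity_root_if_root:
  assumes "g dvd Polynomial.monom 1 n - 1" "ac_eval g x = 0"
  shows "x ^ n = 1" "x \<noteq> 0"
proof -
  obtain h where "Polynomial.monom 1 n - 1 = g * h"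
    using assms(1) by (auto simp: dvd_def)
  from arg_cong[OF this, of "\<lambda>p. ac_eval p x"] show "x ^ n = 1"
    by (simp add: ac_eval_simps assms(2))
  then show "x \<noteq> 0"
    using n_nz by (auto simp: power_0_left)
qed

lemma alpha_unity: "j \<in> I \<Longrightarrow> \<alpha> j ^ n = 1"
  using unity_root_if_root(1)[OF f_dvd root] .

lemma alpha_nz: "j \<in> I \<Longrightarrow> \<alpha> j \<noteq> 0"
  using unity_root_if_root(2)[OF f_dvd root] .

lemma alpha_inverse_unity: "j \<in> I \<Longrightarrow> inverse (\<alpha> j) ^ n = 1"
  by (simp add: power_inverse alpha_unity)

lemma blocks_no_common_root:
  assumes "i \<in> I" "j \<in> I" "i \<noteq> j" "ac_eval (block i) x = 0"
  shows "ac_eval (block j) x \<noteq> 0"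
proof -
  have "Polynomial.monom 1 n - 1 = block i * (\<Prod>l\<in>I - {i}. block l)"
    unfolding prod_block using assms(1) by (intro prod.remove) auto
  then have "ac_eval (\<Prod>l\<in>I - {i}. block l) x \<noteq> 0"
    by (rule no_common_root_if_factors_unity[OF n_unit _ assms(4)])
  then show ?thesis
    using assms by (auto simp: ac_eval_prod)
qed

lemma f_nz: "j \<in> I \<Longrightarrow> f j \<noteq> 0"
  using irreducible by fastforce

lemma mrecip_root_iff:
  "j \<in> I \<Longrightarrow> x \<noteq> 0 \<Longrightarrow> ac_eval (mrecip (f j)) x = 0 \<longleftrightarrow> ac_eval (f j) (inverse x) = 0"
  by (simp add: ac_eval_mrecip_eq_0_iff f_nz)

lemma alpha_cyclic:
  assumes "j \<in> I" "j \<le> zeta n"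
  shows "\<alpha> j = to_ac (gam_sign j)"
proof (cases "j = 1")
  case True
  then show ?thesis
    using root[OF assms(1)] f_1 by (simp add: ac_eval_simps gam_sign_def)
next
  case False
  then have "j = 2" "even n"
    using assms by (auto simp: zeta_def split: if_splits)
  then show ?thesis
    using root[OF assms(1)] f_2 by (simp add: ac_eval_simps gam_sign_def eq_neg_iff_add_eq_0 add.commute)
qed

lemma inverse_gam_sign: "inverse (gam_sign j) = (gam_sign j :: 'k)"
  by (simp add: gam_sign_def)

lemma alpha_cyclic_inverse: "j \<in> I \<Longrightarrow> j \<le> zeta n \<Longrightarrow> inverse (\<alpha> j) = \<alpha> j"
  by (simp add: alpha_cyclic inverse_gam_sign flip: to_ac_inverse)

lemma gam_sign_unity: "j \<in> I \<Longrightarrow> j \<le> zeta n \<Longrightarrow> gam_sign j ^ n = (1 :: 'k)"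
  using alpha_unity[of j] alpha_cyclic[of j] by (metis to_ac_1 to_ac_eq_iff to_ac_power)

text \<open>
  The factor \<open>x - 1\<close> differs from its reciprocal polynomial by a sign, but its root is its own
  inverse.
\<close>

lemma f_inverse_root:
  assumes "j \<in> I" "j \<le> r"
  shows "ac_eval (f j) (inverse (\<alpha> j)) = 0"
proof (cases "j = 1")
  case True
  then show ?thesis
    using root[OF assms(1)] alpha_cyclic_inverse[OF assms(1)] zeta_pos by simp
next
  case False
  then have "reflect_poly (f j) = f j"
    using self_reciprocal[of j] assms by auto
  then show ?thesis
    using root[OF assms(1)] ac_eval_reflect_poly[OF alpha_nz[OF assms(1)], of "f j"]
      alpha_nz[OF assms(1)] by simp
qed

lemma block_root:
  assumes "j \<in> I" "x \<in> {\<alpha> j, inverse (\<alpha> j)}"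
  shows "ac_eval (block j) x = 0"
proof (cases "x = \<alpha> j")
  case True
  then show ?thesis
    using root[OF assms(1)] by (simp add: block_def ac_eval_mult)
next
  case False
  then have x: "x = inverse (\<alpha> j)"
    using assms(2) by simp
  have "ac_eval (mrecip (f j)) (inverse (\<alpha> j)) = 0"
    using mrecip_root_iff[OF assms(1), of "inverse (\<alpha> j)"] root[OF assms(1)] alpha_nz[OF assms(1)]
    by simp
  then show ?thesis
    using f_inverse_root[OF assms(1)] by (simp add: block_def ac_eval_mult x)
qed

lemma f_mrecip_no_common_root:
  assumes "j \<in> I" "r < j"
  shows "ac_eval (f j) (inverse (\<alpha> j)) \<noteq> 0"
proof -
  obtain h where "Polynomial.monom 1 n - 1 = f j * (mrecip (f j) * h)"
    using block_dvd[OF assms(1)] assms(2) by (auto simp: block_def dvd_def mult.assoc)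
  from no_common_root_if_factors_unity[OF n_unit this root[OF assms(1)]]
  have "ac_eval (mrecip (f j)) (\<alpha> j) \<noteq> 0"
    by (simp add: ac_eval_mult)
  then show ?thesis
    using mrecip_root_iff[OF assms(1) alpha_nz[OF assms(1)]] by simp
qed

section \<open>Values of \<open>e\<^sub>g\<close> at the roots\<close>

lemma e_f_value: "j \<in> I \<Longrightarrow> x ^ n = 1 \<Longrightarrow>
    ac_eval (e_poly n (f j)) x = (if ac_eval (f j) x = 0 then 1 else 0)"
  using ac_eval_e_poly[OF n_unit f_dvd] .

lemma e_mrecip_value: "j \<in> I \<Longrightarrow> r < j \<Longrightarrow> x ^ n = 1 \<Longrightarrow>
    ac_eval (e_poly n (mrecip (f j))) x = (if ac_eval (mrecip (f j)) x = 0 then 1 else 0)"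
  using ac_eval_e_poly[OF n_unit mrecip_dvd] .

lemma e_other:
  assumes "i \<in> I" "j \<in> I" "i \<noteq> j" and x: "x \<in> {\<alpha> i, inverse (\<alpha> i)}"
  shows "ac_eval (e_poly n (f j)) x = 0"
    and "r < j \<Longrightarrow> ac_eval (e_poly n (mrecip (f j))) x = 0"
proof -
  have x1: "x ^ n = 1"
    using x alpha_unity alpha_inverse_unity assms(1) by auto
  have "ac_eval (block j) x \<noteq> 0"
    using blocks_no_common_root[OF assms(1-3) block_root[OF assms(1) x]] .
  then have "ac_eval (f j) x \<noteq> 0" "r < j \<Longrightarrow> ac_eval (mrecip (f j)) x \<noteq> 0"
    by (auto simp: block_def ac_eval_mult split: if_splits)
  then show "ac_eval (e_poly n (f j)) x = 0"
    and "r < j \<Longrightarrow> ac_eval (e_poly n (mrecip (f j))) x = 0"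
    using e_f_value[OF assms(2) x1] e_mrecip_value[OF assms(2) _ x1] by auto
qed

lemma e_own:
  assumes "j \<in> I" "j \<le> r" and x: "x \<in> {\<alpha> j, inverse (\<alpha> j)}"
  shows "ac_eval (e_poly n (f j)) x = 1"
  using e_f_value[OF assms(1)] x alpha_unity[OF assms(1)] alpha_inverse_unity[OF assms(1)]
    root[OF assms(1)] f_inverse_root[OF assms(1,2)] by auto

lemma e_own_pair:
  assumes "j \<in> I" "r < j"
  shows "ac_eval (e_poly n (f j)) (\<alpha> j) = 1" "ac_eval (e_poly n (f j)) (inverse (\<alpha> j)) = 0"
    "ac_eval (e_poly n (mrecip (f j))) (\<alpha> j) = 0" "ac_eval (e_poly n (mrecip (f j))) (inverse (\<alpha> j)) = 1"
  using e_f_value[OF assms(1)] e_mrecip_value[OF assms] alpha_unity[OF assms(1)] alpha_inverse_unity[OF assms(1)]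
    root[OF assms(1)] f_mrecip_no_common_root[OF assms] mrecip_root_iff[OF assms(1)] alpha_nz[OF assms(1)]
  by simp_all

text \<open>
  At a root of \<open>f\<^sub>j\<close> the Bezout coefficients are the inverses of \<open>x - 1\<close> and \<open>x + 1\<close>.
\<close>

lemma bezout_at_roots:
  assumes "zeta n < j" "j \<le> r" and x: "x \<in> {\<alpha> j, inverse (\<alpha> j)}"
  shows "ac_eval (F j) x * ac_eval (G j) x * (x\<^sup>2 - 1) = 1"
proof -
  have j: "j \<in> I"
    using assms zeta_pos by auto
  have f0: "ac_eval (f j) x = 0"
    using x root[OF j] f_inverse_root[OF j assms(2)] by auto
  obtain F2 G2 where "[:-1, 1:] * F j + f j * F2 = 1" "[:1, 1:] * G j + f j * G2 = 1"
    using bezout_F bezout_G assms by blast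
  then have "ac_eval ([:-1, 1:] * F j + f j * F2) x = 1" "ac_eval ([:1, 1:] * G j + f j * G2) x = 1"
    by (simp_all only: ac_eval_1)
  moreover have "ac_eval [:-1, 1:] x = x - 1" "ac_eval [:1, 1:] x = x + 1"
    by (simp_all add: ac_eval_simps)
  ultimately have FG: "(x - 1) * ac_eval (F j) x = 1" "(x + 1) * ac_eval (G j) x = 1"
    unfolding ac_eval_add ac_eval_mult f0 by (simp_all only: mult_zero_left add_0_right)
  have "ac_eval (F j) x * ac_eval (G j) x * (x\<^sup>2 - 1) =
      ((x - 1) * ac_eval (F j) x) * ((x + 1) * ac_eval (G j) x)"
    by (simp add: power2_eq_square algebra_simps)
  then show ?thesis
    by (simp only: FG mult_1)
qed

text \<open>
  This makes \<open>Z\<^sub>j\<close> invertible.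
\<close>

lemma alpha_not_inverse:
  assumes "zeta n < j" "j \<le> r"
  shows "inverse (\<alpha> j) \<noteq> \<alpha> j"
proof
  assume "inverse (\<alpha> j) = \<alpha> j"
  moreover have "\<alpha> j \<noteq> 0"
    using alpha_nz assms zeta_pos by auto
  ultimately have "(\<alpha> j)\<^sup>2 = 1"
    using right_inverse[of "\<alpha> j"] by (simp add: power2_eq_square)
  then show False
    using bezout_at_roots[OF assms, of "\<alpha> j"] by simp
qed

section \<open>The projections are algebra homomorphisms\<close>

lemma proj_cases [case_names cyclic self_reciprocal pair]:
  obtains "j \<le> zeta n" | "zeta n < j" "j \<le> r" | "zeta n < j" "r < j"
  using zeta_le by linarith

lemma comp_alg_ops:
  "j \<le> zeta n \<Longrightarrow> A j = relabel Inl projl grp_alg"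
  "zeta n < j \<Longrightarrow> j \<le> r \<Longrightarrow> A j = relabel Inr projr (mat_alg (adjoin (\<alpha> j + inverse (\<alpha> j))))"
  "zeta n < j \<Longrightarrow> r < j \<Longrightarrow> A j = relabel Inr projr (mat_alg (adjoin (\<alpha> j)))"
  by (simp_all add: comp_alg_def)

lemma proj_eqs:
  "j \<le> zeta n \<Longrightarrow> proj n r \<alpha> j u = Inl (gam j u)"
  "zeta n < j \<Longrightarrow> j \<le> r \<Longrightarrow> proj n r \<alpha> j u = Inr (sig (\<alpha> j) (tau (\<alpha> j) u))"
  "zeta n < j \<Longrightarrow> r < j \<Longrightarrow> proj n r \<alpha> j u = Inr (tau (\<alpha> j) u)"
  by (simp_all add: proj_def)

lemmas alg_ops = relabel_def grp_alg_def mat_alg_def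

lemma proj_add:
  assumes "j \<in> I"
  shows "proj n r \<alpha> j (u + v) = proj n r \<alpha> j u \<oplus>\<^bsub>A j\<^esub> proj n r \<alpha> j v"
  by (cases j rule: proj_cases)
    (simp_all add: comp_alg_ops proj_eqs alg_ops gam_add tau_add sig_add)

lemma proj_mult:
  fixes u v :: "'n :: nontriv dih \<Rightarrow>\<^sub>0 'k"
  assumes n: "n = CARD('n)" and j: "j \<in> I"
  shows "proj n r \<alpha> j (u * v) = proj n r \<alpha> j u \<otimes>\<^bsub>A j\<^esub> proj n r \<alpha> j v"
proof (cases j rule: proj_cases)
  case cyclic
  then show ?thesis
    using gam_mult[OF gam_sign_unity[OF j cyclic, unfolded n]]
    by (simp add: comp_alg_ops proj_eqs alg_ops)
next
  case self_reciprocal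
  then show ?thesis
    using tau_mult[OF alpha_unity[OF j, unfolded n], of u v] sig_mult[OF alpha_not_inverse]
    by (simp add: comp_alg_ops proj_eqs alg_ops)
next
  case pair
  then show ?thesis
    using tau_mult[OF alpha_unity[OF j, unfolded n], of u v]
    by (simp add: comp_alg_ops proj_eqs alg_ops)
qed

lemma proj_smult:
  fixes u :: "'n :: nontriv dih \<Rightarrow>\<^sub>0 'k"
  assumes n: "n = CARD('n)" and j: "j \<in> I"
  shows "proj n r \<alpha> j (scal c * u) = c \<odot>\<^bsub>A j\<^esub> proj n r \<alpha> j u"
proof (cases j rule: proj_cases)
  case cyclic
  then show ?thesis
    using gam_mult[OF gam_sign_unity[OF j cyclic, unfolded n]]
    by (simp add: comp_alg_ops proj_eqs alg_ops gam_scal)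
next
  case self_reciprocal
  then show ?thesis
    using tau_mult[OF alpha_unity[OF j, unfolded n], of "scal c" u] sig_mult[OF alpha_not_inverse]
      sig_scalar[OF alpha_not_inverse]
    by (simp add: comp_alg_ops proj_eqs alg_ops tau_scal flip: mat2_scalar_mult)
next
  case pair
  then show ?thesis
    using tau_mult[OF alpha_unity[OF j, unfolded n], of "scal c" u]
    by (simp add: comp_alg_ops proj_eqs alg_ops tau_scal mat2_scalar_mult)
qed

lemma proj_0:
  assumes "j \<in> I"
  shows "proj n r \<alpha> j 0 = \<zero>\<^bsub>A j\<^esub>"
proof (cases j rule: proj_cases)
  case cyclic
  then show ?thesis
    using gam_add[of j 0 0] by (simp add: comp_alg_ops proj_eqs alg_ops)
next
  case self_reciprocal
  then show ?thesis
    using sig_add[of "\<alpha> j" 0 0] by (simp add: comp_alg_ops proj_eqs alg_ops tau_0)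
next
  case pair
  then show ?thesis
    by (simp add: comp_alg_ops proj_eqs alg_ops tau_0)
qed

lemma comp_alg_zero:
  assumes "j \<in> I"
  shows "Y \<in> carrier (A j) \<Longrightarrow> \<zero>\<^bsub>A j\<^esub> \<oplus>\<^bsub>A j\<^esub> Y = Y"
    and "Y \<in> carrier (A j) \<Longrightarrow> Y \<oplus>\<^bsub>A j\<^esub> \<zero>\<^bsub>A j\<^esub> = Y"
    and "\<zero>\<^bsub>A j\<^esub> \<otimes>\<^bsub>A j\<^esub> \<zero>\<^bsub>A j\<^esub> = \<zero>\<^bsub>A j\<^esub>"
    and "c \<odot>\<^bsub>A j\<^esub> \<zero>\<^bsub>A j\<^esub> = \<zero>\<^bsub>A j\<^esub>"
    and "\<zero>\<^bsub>A j\<^esub> \<in> carrier (A j)"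
proof -
  have mat0: "(0 :: 'k alg_closure ^ 2 ^ 2) ** 0 = 0" "(\<chi> i j. 0) = (0 :: 'k alg_closure ^ 2 ^ 2)"
    by (simp_all add: vec_eq_iff matrix_matrix_mult_def)
  show "Y \<in> carrier (A j) \<Longrightarrow> \<zero>\<^bsub>A j\<^esub> \<oplus>\<^bsub>A j\<^esub> Y = Y"
    and "Y \<in> carrier (A j) \<Longrightarrow> Y \<oplus>\<^bsub>A j\<^esub> \<zero>\<^bsub>A j\<^esub> = Y"
    and "\<zero>\<^bsub>A j\<^esub> \<otimes>\<^bsub>A j\<^esub> \<zero>\<^bsub>A j\<^esub> = \<zero>\<^bsub>A j\<^esub>"
    and "c \<odot>\<^bsub>A j\<^esub> \<zero>\<^bsub>A j\<^esub> = \<zero>\<^bsub>A j\<^esub>"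
    and "\<zero>\<^bsub>A j\<^esub> \<in> carrier (A j)"
    by (cases j rule: proj_cases; auto simp: comp_alg_ops alg_ops mat0 adjoin_consts)+
qed

text \<open>
  In the self-reciprocal case the entries lie a priori in \<open>k[\<alpha>\<^sub>j]\<close>.  Conjugation by \<open>Z\<^sub>j\<close> takes the
  images of \<open>a\<close> and \<open>b\<close>, hence the whole image, into matrices over \<open>k[\<alpha>\<^sub>j + \<alpha>\<^sub>j\<^sup>-\<^sup>1]\<close>.
\<close>

lemma proj_closed:
  fixes u :: "'n :: nontriv dih \<Rightarrow>\<^sub>0 'k"
  assumes n: "n = CARD('n)" and j: "j \<in> I"
  shows "proj n r \<alpha> j u \<in> carrier (A j)"
proof (cases j rule: proj_cases)
  case cyclic
  then show ?thesis
    by (simp add: comp_alg_ops proj_eqs alg_ops)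
next
  case self_reciprocal
  note ne = alpha_not_inverse[OF self_reciprocal]
  note x = alpha_unity[OF j, unfolded n]
  let ?t = "\<alpha> j + inverse (\<alpha> j)"
  have nz: "\<alpha> j \<noteq> 0"
    using alpha_nz[OF j] .
  have "sig (\<alpha> j) (tau (\<alpha> j) u) \<in> carrier (mat_alg (adjoin ?t))"
  proof (induction u rule: dih_alg_induct)
    case (scal c)
    show ?case
      by (simp add: tau_scal sig_scalar[OF ne] in_carrier_mat_alg to_ac_in_adjoin adjoin_consts)
  next
    case gen_a
    have "sig (\<alpha> j) (tau (\<alpha> j) (gen_a :: 'n dih \<Rightarrow>\<^sub>0 'k)) = mat2 0 1 (- 1) ?t"
      \<comment> \<open>the companion matrix of the quadratic equation z^2 - t z + 1 = 0 of \<open>\<alpha>\<^sub>j\<close> over k[t]\<close>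
      unfolding sig_eq_iff[OF ne] tau_gen_a[OF x] Zmat_def mat2_mult mat2_eq_iff
      using nz by (simp add: algebra_simps)
    then show ?case
      by (simp add: in_carrier_mat_alg adjoin_consts adjoin_uminus self_in_adjoin)
  next
    case gen_b
    have "sig (\<alpha> j) (tau (\<alpha> j) (gen_b :: 'n dih \<Rightarrow>\<^sub>0 'k)) = mat2 1 (- ?t) 0 (- 1)"
      unfolding sig_eq_iff[OF ne] tau_gen_b[OF x] Zmat_def mat2_mult mat2_eq_iff
      using nz by (simp add: algebra_simps)
    then show ?case
      using adjoin_uminus[OF self_in_adjoin[of ?t]]
      by (simp only: in_carrier_mat_alg) (simp add: adjoin_consts adjoin_uminus)
  next
    case (add u v)
    then show ?case
      by (simp add: tau_add sig_add mat_alg_adjoin_closed)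
  next
    case (mult u v)
    then show ?case
      by (simp add: tau_mult[OF x] sig_mult[OF ne] mat_alg_adjoin_closed)
  qed
  then show ?thesis
    using self_reciprocal by (simp add: comp_alg_ops proj_eqs relabel_def)
next
  case pair
  have "adjoin (inverse (\<alpha> j)) = adjoin (\<alpha> j)"
    using adjoin_inverse_unity_root[OF alpha_unity[OF j] n_nz] .
  then have "inverse (\<alpha> j) \<in> adjoin (\<alpha> j)"
    using self_in_adjoin[of "inverse (\<alpha> j)"] by simp
  then have "tau (\<alpha> j) u \<in> carrier (mat_alg (adjoin (\<alpha> j)))"
    by (simp add: tau_def in_carrier_mat_alg ac_eval_in_adjoin self_in_adjoin)
  then show ?thesis
    using pair by (simp add: comp_alg_ops proj_eqs relabel_def)
qed

section \<open>Joint injectivity\<close>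

text \<open>
  Every \<open>n\<close>-th root of unity \<open>y\<close> is a conjugate of some \<open>\<alpha>\<^sub>j\<close> or of some \<open>\<alpha>\<^sub>j\<^sup>-\<^sup>1\<close>.  In the second
  case the reciprocal polynomial of \<open>p\<close> is divisible by \<open>f\<^sub>j\<close>, whose roots include \<open>y\<^sup>-\<^sup>1\<close>.
\<close>

lemma vanishes_on_unity_roots:
  assumes p: "\<And>j x. j \<in> I \<Longrightarrow> x \<in> {\<alpha> j, inverse (\<alpha> j)} \<Longrightarrow> ac_eval p x = 0"
    and y: "y ^ n = 1"
  shows "ac_eval p y = 0"
proof -
  have y_nz: "y \<noteq> 0"
    using y n_nz by (auto simp: power_0_left)
  have "ac_eval (\<Prod>j\<in>I. block j) y = 0"
    using y unfolding prod_block[symmetric] by (simp add: ac_eval_simps)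
  then obtain j where j: "j \<in> I" and "ac_eval (block j) y = 0"
    by (auto simp: ac_eval_prod)
  then consider "ac_eval (f j) y = 0" | "ac_eval (f j) (inverse y) = 0"
    using mrecip_root_iff[OF j y_nz] by (auto simp: block_def ac_eval_mult split: if_splits)
  then show ?thesis
  proof cases
    case 1
    have "f j dvd p"
      using minimal_poly_dvd[OF irreducible[OF j] root[OF j]] p[OF j] by simp
    then show ?thesis
      using 1 by (auto simp: dvd_def ac_eval_mult)
  next
    case 2
    have "ac_eval (reflect_poly p) (\<alpha> j) = 0"
      using p[OF j] by (simp add: ac_eval_reflect_poly alpha_nz[OF j])
    then have "f j dvd reflect_poly p"
      using minimal_poly_dvd[OF irreducible[OF j] root[OF j]] by simp
    then have "ac_eval (reflect_poly p) (inverse y) = 0"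
      using 2 by (auto simp: dvd_def ac_eval_mult)
    then show ?thesis
      using y_nz by (simp add: ac_eval_reflect_poly)
  qed
qed

text \<open>
  The component of \<open>P(a) + b Q(a)\<close> at \<open>j\<close> determines the values of \<open>P\<close> and \<open>Q\<close> at \<open>\<alpha>\<^sub>j\<close> and \<open>\<alpha>\<^sub>j\<^sup>-\<^sup>1\<close>.
\<close>

lemma parts_at_roots:
  fixes u v :: "'n :: nontriv dih \<Rightarrow>\<^sub>0 'k"
  assumes j: "j \<in> I" and eq: "proj n r \<alpha> j u = proj n r \<alpha> j v" and x: "x \<in> {\<alpha> j, inverse (\<alpha> j)}"
  shows "ac_eval (P_part u) x = ac_eval (P_part v) x" "ac_eval (Q_part u) x = ac_eval (Q_part v) x"
proof -
  have "ac_eval (P_part u) x = ac_eval (P_part v) x \<and> ac_eval (Q_part u) x = ac_eval (Q_part v) x"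
  proof (cases j rule: proj_cases)
    case cyclic
    have x: "x = to_ac (gam_sign j)"
      using x alpha_cyclic[OF j cyclic] alpha_cyclic_inverse[OF j cyclic] by auto
    show ?thesis
      using eq unfolding proj_eqs(1)[OF cyclic] x ac_eval_to_ac by (simp add: gam_alt cyc2_eq_iff)
  next
    case self_reciprocal
    have "tau (\<alpha> j) u = tau (\<alpha> j) v"
      using eq sig_inj[OF alpha_not_inverse[OF self_reciprocal]] self_reciprocal by (simp add: proj_eqs)
    then show ?thesis
      using x by (auto simp: tau_def mat2_eq_iff)
  next
    case pair
    then have "tau (\<alpha> j) u = tau (\<alpha> j) v"
      using eq by (simp add: proj_eqs)
    then show ?thesis
      using x by (auto simp: tau_def mat2_eq_iff)
  qed
  then show "ac_eval (P_part u) x = ac_eval (P_part v) x" "ac_eval (Q_part u) x = ac_eval (Q_part v) x"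
    by simp_all
qed

text \<open>
  \<open>P\<close> and \<open>Q\<close> have degree less than \<open>n\<close>, and the components determine their values at all \<open>n\<close>
  roots of unity.
\<close>

lemma proj_jointly_inj:
  fixes u v :: "'n :: nontriv dih \<Rightarrow>\<^sub>0 'k"
  assumes n: "n = CARD('n)" and eq: "\<And>j. j \<in> I \<Longrightarrow> proj n r \<alpha> j u = proj n r \<alpha> j v"
  shows "u = v"
proof -
  have "p = q" if "Polynomial.degree p < n" "Polynomial.degree q < n"
    and pq: "\<And>j x. j \<in> I \<Longrightarrow> x \<in> {\<alpha> j, inverse (\<alpha> j)} \<Longrightarrow> ac_eval p x = ac_eval q x" for p q :: "'k poly"
  proof -
    have "ac_eval (p - q) x = 0" if "x ^ n = 1" for x
      by (rule vanishes_on_unity_roots[OF _ that]) (simp only: ac_eval_diff pq diff_self)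
    then have "p - q = 0"
      using that(1,2) by (intro eq_0_if_vanishes_on_unity_roots[OF n_unit] degree_diff_less)
    then show ?thesis
      by simp
  qed
  then have "P_part u = P_part v" "Q_part u = Q_part v"
    using parts_at_roots[OF _ eq] dih_alg_decomp(1,2) unfolding n by blast+
  then show ?thesis
    using dih_alg_decomp(3)[of u] dih_alg_decomp(3)[of v] by simp
qed

section \<open>The inverse maps\<close>

lemma eps_graph_total:
  assumes j: "j \<in> I" and Y: "Y \<in> carrier (A j)"
  shows "\<exists>u :: 'n :: nontriv dih \<Rightarrow>\<^sub>0 'k. eps_graph n r f F G \<alpha> j Y u"
proof (cases j rule: proj_cases)
  case cyclic
  obtain v where "Y = Inl v"
    using Y cyclic by (auto simp: comp_alg_ops relabel_def)
  then have "Y = Inl (scal (Poly_Mapping.lookup v 0) + scal (Poly_Mapping.lookup v 1) * gen_h)"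
    using cyc2_decomp[of v] by simp
  then show ?thesis
    using eps_graph.cyc[OF cyclic] by metis
next
  case self_reciprocal
  obtain a b c d where "Y = Inr (mat2 a b c d)" and "mat2 a b c d \<in> carrier (mat_alg (adjoin (\<alpha> j + inverse (\<alpha> j))))"
    using Y self_reciprocal by (auto simp: comp_alg_ops relabel_def) (metis mat2_surj)
  then obtain M P N Q where "Y = Inr (mat2 (ac_eval M (\<alpha> j + inverse (\<alpha> j))) (ac_eval P (\<alpha> j + inverse (\<alpha> j)))
      (ac_eval N (\<alpha> j + inverse (\<alpha> j))) (ac_eval Q (\<alpha> j + inverse (\<alpha> j))))"
    unfolding in_carrier_mat_alg adjoin_def by blast
  then show ?thesis
    using eps_graph.self_recip[OF self_reciprocal refl refl refl refl] by metis
next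
  case pair
  obtain a b c d where "Y = Inr (mat2 a b c d)" and "mat2 a b c d \<in> carrier (mat_alg (adjoin (\<alpha> j)))"
    using Y pair by (auto simp: comp_alg_ops relabel_def) (metis mat2_surj)
  moreover have "adjoin (inverse (\<alpha> j)) = adjoin (\<alpha> j)"
    using adjoin_inverse_unity_root[OF alpha_unity[OF j] n_nz] .
  ultimately have "Y = Inr (mat2 a b c d)" "a \<in> adjoin (\<alpha> j)" "b \<in> adjoin (inverse (\<alpha> j))"
    "c \<in> adjoin (\<alpha> j)" "d \<in> adjoin (inverse (\<alpha> j))"
    by (simp_all add: in_carrier_mat_alg)
  then obtain M P N Q where "Y = Inr (mat2 (ac_eval M (\<alpha> j)) (ac_eval P (inverse (\<alpha> j)))
      (ac_eval N (\<alpha> j)) (ac_eval Q (inverse (\<alpha> j))))"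
    unfolding adjoin_def by blast
  then show ?thesis
    using eps_graph.pair[OF pair] by metis
qed

lemma proj_mult_vanishing:
  fixes v :: "'n :: nontriv dih \<Rightarrow>\<^sub>0 'k"
  assumes n: "n = CARD('n)" and j: "j \<in> I"
    and zero: "ac_eval p (\<alpha> j) = 0" "ac_eval p (inverse (\<alpha> j)) = 0"
  shows "proj n r \<alpha> j (v * aeval p gen_a) = \<zero>\<^bsub>A j\<^esub>"
proof (cases j rule: proj_cases)
  case cyclic
  note s = gam_sign_unity[OF j cyclic, unfolded n]
  have "poly p (gam_sign j) = 0"
    using zero(1) unfolding alpha_cyclic[OF j cyclic] ac_eval_to_ac by simp
  then show ?thesis
    using cyclic by (simp add: proj_eqs comp_alg_ops alg_ops gam_mult[OF s] gam_aeval[OF s]) (simp add: scal_def)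
next
  case self_reciprocal
  note x = alpha_unity[OF j, unfolded n]
  have "tau (\<alpha> j) (v * aeval p gen_a) = 0"
    unfolding tau_mult[OF x] tau_aeval[OF x tau_gen_a[OF x]] zero mat2_0[symmetric]
    by (simp add: vec_eq_iff matrix_matrix_mult_def)
  then show ?thesis
    using self_reciprocal sig_add[of "\<alpha> j" 0 0] by (simp add: proj_eqs comp_alg_ops alg_ops)
next
  case pair
  note x = alpha_unity[OF j, unfolded n]
  have "tau (\<alpha> j) (v * aeval p gen_a) = 0"
    unfolding tau_mult[OF x] tau_aeval[OF x tau_gen_a[OF x]] zero mat2_0[symmetric]
    by (simp add: vec_eq_iff matrix_matrix_mult_def)
  then show ?thesis
    using pair by (simp add: proj_eqs comp_alg_ops alg_ops)
qed

text \<open>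
  Each summand of a value of \<open>\<epsilon>\<^sub>j\<close> is a multiple of \<open>e\<^sub>g(a)\<close> for a factor \<open>g\<close> that belongs to \<open>j\<close>, and
  \<open>e\<^sub>g\<close> vanishes at \<open>\<alpha>\<^sub>i\<close> and \<open>\<alpha>\<^sub>i\<^sup>-\<^sup>1\<close>.
\<close>

lemma proj_other_eps_graph:
  fixes u :: "'n :: nontriv dih \<Rightarrow>\<^sub>0 'k"
  assumes n: "n = CARD('n)" and ij: "i \<in> I" "j \<in> I" "i \<noteq> j" and u: "eps_graph n r f F G \<alpha> j Y u"
  shows "proj n r \<alpha> i u = \<zero>\<^bsub>A i\<^esub>"
proof -
  have kill: "proj n r \<alpha> i (v * aeval (e_poly n (f j)) gen_a) = \<zero>\<^bsub>A i\<^esub>" for v :: "'n dih \<Rightarrow>\<^sub>0 'k"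
    using e_other(1)[OF ij] by (intro proj_mult_vanishing[OF n ij(1)]) auto
  show ?thesis
    using u
  proof cases
    case (pair M P N Q)
    have "proj n r \<alpha> i (v * aeval (e_poly n (mrecip (f j))) gen_a) = \<zero>\<^bsub>A i\<^esub>" for v :: "'n dih \<Rightarrow>\<^sub>0 'k"
      using e_other(2)[OF ij] pair by (intro proj_mult_vanishing[OF n ij(1)]) auto
    then show ?thesis
      by (simp add: pair(2) proj_add[OF ij(1)] kill comp_alg_zero[OF ij(1)])
  qed (simp_all only: kill)
qed

text \<open>
  In the first two cases \<open>e(a)\<close> is mapped to the unit, as \<open>e\<close> has the value 1 at \<open>\<alpha>\<^sub>j\<close> and at
  \<open>\<alpha>\<^sub>j\<^sup>-\<^sup>1\<close>.  In the third case the two polynomials \<open>e\<close> are mapped to the diagonal matrix units, which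
  select the first column of the image of \<open>M(a) + b N(a)\<close> and the second one of the image of
  \<open>Q(a) + b P(a)\<close>.
\<close>

lemma proj_eps_graph:
  fixes u :: "'n :: nontriv dih \<Rightarrow>\<^sub>0 'k"
  assumes n: "n = CARD('n)" and j: "j \<in> I" and u: "eps_graph n r f F G \<alpha> j Y u"
  shows "proj n r \<alpha> j u = Y"
proof -
  note x = alpha_unity[OF j, unfolded n]
  note tau_a = tau_aeval[OF x tau_gen_a[OF x]]
  show ?thesis
    using u
  proof cases
    case (cyc w1 w2)
    note s = gam_sign_unity[OF j cyc(3), unfolded n]
    have "j \<le> r"
      using cyc(3) zeta_le by simp
    then have "poly (e_poly n (f j)) (gam_sign j) = 1"
      using e_own[OF j, of "\<alpha> j"] unfolding alpha_cyclic[OF j cyc(3)] ac_eval_to_ac by simp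
    moreover have "(scal 1 :: bit \<Rightarrow>\<^sub>0 'k) = 1"
      by (simp add: scal_def)
    ultimately show ?thesis
      by (simp add: proj_eqs(1)[OF cyc(3)] cyc(1,2) gam_mult[OF s] gam_add gam_scal gam_gen_b[OF s] gam_aeval[OF s])
  next
    case (self_recip t c T1 M N P Q T2)
    define y where "y = inverse (\<alpha> j)"
    have xy: "\<alpha> j * y = 1"
      using alpha_nz[OF j] by (simp add: y_def)
    have c: "tau (\<alpha> j) c = mat2 t 0 0 t"
      unfolding self_recip by (simp add: tau_add tau_gen_a[OF x] tau_gen_a_inv[OF x] mat2_add add.commute)
    define d where "d z = ac_eval (F j) z * ac_eval (G j) z" for z
    note tau_simps = tau_mult[OF x] tau_add tau_uminus tau_a tau_aeval[OF x c] tau_gen_a[OF x]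
      tau_gen_a_inv[OF x] tau_gen_b[OF x] mat2_add mat2_mult mat2_uminus power2_eq_square
    note diff = diff_conv_add_uminus
    have e: "tau (\<alpha> j) (v * aeval (e_poly n (f j)) gen_a) = tau (\<alpha> j) v" for v :: "'n dih \<Rightarrow>\<^sub>0 'k"
      using e_own[OF j self_recip(4), of "\<alpha> j"] e_own[OF j self_recip(4), of "inverse (\<alpha> j)"]
      by (simp add: tau_mult[OF x] tau_a flip: mat2_1)
    have "tau (\<alpha> j) u = mat2
        (d (\<alpha> j) * (- ac_eval M t + \<alpha> j * ac_eval N t - \<alpha> j * ac_eval P t + (\<alpha> j)\<^sup>2 * ac_eval Q t))
        (d y * (- ac_eval M t + \<alpha> j * ac_eval N t - y * ac_eval P t + ac_eval Q t))
        (d (\<alpha> j) * (- ac_eval M t + y * ac_eval N t - \<alpha> j * ac_eval P t + ac_eval Q t))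
        (d y * (- ac_eval M t + y * ac_eval N t - y * ac_eval P t + y\<^sup>2 * ac_eval Q t))"
      unfolding self_recip(2) e self_recip(7,8) diff d_def y_def
      by (simp only: tau_simps) (simp add: mat2_eq_iff)
    then have "tau (\<alpha> j) u ** Zmat (\<alpha> j) =
        Zmat (\<alpha> j) ** mat2 (ac_eval M t) (ac_eval P t) (ac_eval N t) (ac_eval Q t)"
      using companion_identities[OF xy, of "d (\<alpha> j)" "d y"]
        bezout_at_roots[OF self_recip(3,4), of "\<alpha> j"] bezout_at_roots[OF self_recip(3,4), of y]
      by (simp add: d_def y_def)
    then show ?thesis
      unfolding proj_eqs(2)[OF self_recip(3,4)] self_recip(1)
      using sig_eq_iff[OF alpha_not_inverse[OF self_recip(3,4)]] by simp
  next
    case (pair M P N Q)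
    show ?thesis
      unfolding proj_eqs(3)[OF pair(3,4)] pair(1,2)
      by (simp add: tau_add tau_mult[OF x] tau_a tau_gen_b[OF x] e_own_pair[OF j pair(4)] mat2_add mat2_mult)
  qed
qed

text \<open>
  A value of \<open>\<epsilon>\<^sub>j\<close> at \<open>Y\<close> has the components \<open>Y\<close> at \<open>j\<close> and 0 elsewhere, whichever polynomials represent
  \<open>Y\<close>.
\<close>

lemma eps_graph_unique:
  fixes u v :: "'n :: nontriv dih \<Rightarrow>\<^sub>0 'k"
  assumes n: "n = CARD('n)" and j: "j \<in> I"
    and "eps_graph n r f F G \<alpha> j Y u" "eps_graph n r f F G \<alpha> j Y v"
  shows "u = v"
proof (rule proj_jointly_inj[OF n])
  fix i
  assume i: "i \<in> I"
  show "proj n r \<alpha> i u = proj n r \<alpha> i v"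
  proof (cases "i = j")
    case True
    then show ?thesis
      using proj_eps_graph[OF n j] assms(3,4) by simp
  next
    case False
    then show ?thesis
      using proj_other_eps_graph[OF n i j] assms(3,4) by simp
  qed
qed

lemma proj_eps:
  assumes n: "n = CARD('n :: nontriv)" and ij: "i \<in> I" "j \<in> I" and Y: "Y \<in> carrier (A j)"
  shows "proj n r \<alpha> i (eps n r f F G \<alpha> j Y :: 'n dih \<Rightarrow>\<^sub>0 'k) = (if i = j then Y else \<zero>\<^bsub>A i\<^esub>)"
proof -
  obtain u :: "'n dih \<Rightarrow>\<^sub>0 'k" where u: "eps_graph n r f F G \<alpha> j Y u"
    using eps_graph_total[OF ij(2) Y] by blast
  then have "eps n r f F G \<alpha> j Y = u"
    unfolding eps_def by (rule the_equality) (rule eps_graph_unique[OF n ij(2) _ u])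
  then show ?thesis
    using u proj_eps_graph[OF n ij(2)] proj_other_eps_graph[OF n ij] by auto
qed

text \<open>
  Both sides of each identity have the same components: at \<open>j\<close> because the projection is a
  homomorphism and inverts \<open>\<epsilon>\<^sub>j\<close>, elsewhere because everything is 0.
\<close>

lemma eps_alg_mono:
  assumes n: "n = CARD('n :: nontriv)" and j: "j \<in> I"
  shows "alg_mono (A j) grp_alg (eps n r f F G \<alpha> j :: 'k comp \<Rightarrow> ('n dih \<Rightarrow>\<^sub>0 'k))"
proof -
  let ?e = "eps n r f F G \<alpha> j :: 'k comp \<Rightarrow> ('n dih \<Rightarrow>\<^sub>0 'k)"
  note val = proj_eps[OF n _ j]
  note in_A = proj_closed[OF n j]
  have add: "?e (Y \<oplus>\<^bsub>A j\<^esub> Z) = ?e Y + ?e Z" if Y: "Y \<in> carrier (A j)" and Z: "Z \<in> carrier (A j)" for Y Z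
  proof (rule proj_jointly_inj[OF n])
    have "Y \<oplus>\<^bsub>A j\<^esub> Z \<in> carrier (A j)"
      using in_A[of "?e Y + ?e Z"] unfolding proj_add[OF j] val[OF j Y] val[OF j Z] by simp
    then show "proj n r \<alpha> i (?e (Y \<oplus>\<^bsub>A j\<^esub> Z)) = proj n r \<alpha> i (?e Y + ?e Z)" if "i \<in> I" for i
      using that by (simp add: proj_add[OF that] val[OF that] Y Z comp_alg_zero[OF that])
  qed
  have mult: "?e (Y \<otimes>\<^bsub>A j\<^esub> Z) = ?e Y * ?e Z" if Y: "Y \<in> carrier (A j)" and Z: "Z \<in> carrier (A j)" for Y Z
  proof (rule proj_jointly_inj[OF n])
    have "Y \<otimes>\<^bsub>A j\<^esub> Z \<in> carrier (A j)"
      using in_A[of "?e Y * ?e Z"] unfolding proj_mult[OF n j] val[OF j Y] val[OF j Z] by simp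
    then show "proj n r \<alpha> i (?e (Y \<otimes>\<^bsub>A j\<^esub> Z)) = proj n r \<alpha> i (?e Y * ?e Z)" if "i \<in> I" for i
      using that by (simp add: proj_mult[OF n that] val[OF that] Y Z comp_alg_zero[OF that])
  qed
  have smult: "?e (c \<odot>\<^bsub>A j\<^esub> Y) = scal c * ?e Y" if Y: "Y \<in> carrier (A j)" for c Y
  proof (rule proj_jointly_inj[OF n])
    have "c \<odot>\<^bsub>A j\<^esub> Y \<in> carrier (A j)"
      using in_A[of "scal c * ?e Y"] unfolding proj_smult[OF n j] val[OF j Y] by simp
    then show "proj n r \<alpha> i (?e (c \<odot>\<^bsub>A j\<^esub> Y)) = proj n r \<alpha> i (scal c * ?e Y)" if "i \<in> I" for i
      using that by (simp add: proj_smult[OF n that] val[OF that] Y comp_alg_zero[OF that])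
  qed
  have "inj_on ?e (carrier (A j))"
    by (rule inj_on_inverseI[where g = "proj n r \<alpha> j"]) (simp add: val[OF j])
  then show ?thesis
    by (simp add: alg_mono_def grp_alg_def add mult smult)
qed

lemma proj_sum_eps:
  assumes n: "n = CARD('n :: nontriv)" and i: "i \<in> I" and J: "J \<subseteq> I"
    and w: "\<And>j. j \<in> I \<Longrightarrow> w j \<in> carrier (A j)"
  shows "proj n r \<alpha> i (\<Sum>j\<in>J. eps n r f F G \<alpha> j (w j) :: 'n dih \<Rightarrow>\<^sub>0 'k)
    = (if i \<in> J then w i else \<zero>\<^bsub>A i\<^esub>)"
proof -
  have "finite J"
    using J by (rule finite_subset) simp
  then show ?thesis
    using J
  proof induction
    case empty
    then show ?case
      by (simp add: proj_0[OF i])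
  next
    case (insert j J)
    then show ?case
      using w[of j] comp_alg_zero(1,2)[OF i w[OF i]] comp_alg_zero(1)[OF i comp_alg_zero(5)[OF i]]
      by (auto simp: proj_add[OF i] proj_eps[OF n i])
  qed
qed

end

theorem theorem2:
  fixes q n r s :: nat
    and f F1 F2 G1 G2 :: "nat \<Rightarrow> 'k :: {field, finite} poly"
    and \<alpha> :: "nat \<Rightarrow> 'k alg_closure"
  assumes q: "q = CARD('k)"
    and n: "n = CARD('n :: nontriv)" "n \<ge> 2"
    and coprime: "coprime q n"
    and factorization:
      "Polynomial.monom 1 n - 1 = (\<Prod>j=1..r. f j) * (\<Prod>j=r+1..r+s. f j * mrecip (f j))"
    and factors_distinct:
      "distinct (map f [1..<r+s+1] @ map (\<lambda>j. mrecip (f j)) [r+1..<r+s+1])"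
    and monic_irreducible: "\<And>j. j \<in> {1..r+s} \<Longrightarrow> Polynomial.lead_coeff (f j) = 1 \<and> Factorial_Ring.irreducible (f j)"
    and zeta_le: "zeta n \<le> r"
    and f_1: "f 1 = [:-1, 1:]"
    and f_2: "even n \<Longrightarrow> f 2 = [:1, 1:]"
    and self_reciprocal: "\<And>j. 1 < j \<Longrightarrow> j \<le> r \<Longrightarrow> reflect_poly (f j) = f j"
    and different_roots: "\<And>j. j \<in> {r+1..r+s} \<Longrightarrow>
      {x. ac_eval (f j) x = 0} \<noteq> {x. ac_eval (reflect_poly (f j)) x = 0}"
    and root: "\<And>j. j \<in> {1..r+s} \<Longrightarrow> ac_eval (f j) (\<alpha> j) = 0"
    and bezout_F: "\<And>j. j \<in> {zeta n + 1..r} \<Longrightarrow> [:-1, 1:] * F1 j + f j * F2 j = 1"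
    and bezout_G: "\<And>j. j \<in> {zeta n + 1..r} \<Longrightarrow> [:1, 1:] * G1 j + f j * G2 j = 1"
  defines "A \<equiv> comp_alg n r \<alpha>"
    and "\<P> \<equiv> (proj n r \<alpha> :: nat \<Rightarrow> ('n dih \<Rightarrow>\<^sub>0 'k) \<Rightarrow> 'k comp)"
    and "\<epsilon> \<equiv> (eps n r f F1 G1 \<alpha> :: nat \<Rightarrow> 'k comp \<Rightarrow> ('n dih \<Rightarrow>\<^sub>0 'k))"
    and "\<P>all \<equiv> (\<lambda>u. \<lambda>j\<in>{1..r+s}. proj n r \<alpha> j (u :: 'n dih \<Rightarrow>\<^sub>0 'k))"
  shows "(\<forall>j\<in>{1..r+s}. \<forall>Y\<in>carrier (A j). \<exists>!u :: 'n dih \<Rightarrow>\<^sub>0 'k. eps_graph n r f F1 G1 \<alpha> j Y u)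
    \<and> bij_betw \<P>all UNIV (PiE {1..r+s} (\<lambda>j. carrier (A j)))
    \<and> (\<forall>w\<in>PiE {1..r+s} (\<lambda>j. carrier (A j)). inv_into UNIV \<P>all w = (\<Sum>j=1..r+s. \<epsilon> j (w j)))
    \<and> (\<forall>j\<in>{1..r+s}. alg_mono (A j) grp_alg (\<epsilon> j))
    \<and> (\<forall>j\<in>{1..r+s}. \<forall>Y\<in>carrier (A j). \<P> j (\<epsilon> j Y) = Y)
    \<and> (\<forall>i\<in>{1..r+s}. \<forall>j\<in>{1..r+s}. i \<noteq> j \<longrightarrow>
         (\<forall>Y\<in>carrier (A j). \<P> i (\<epsilon> j Y) = \<zero>\<^bsub>A i\<^esub>))"
proof -
  have unit: "of_nat n \<noteq> (0 :: 'k)"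
  proof
    assume "of_nat n = (0 :: 'k)"
    then have "CHAR('k) dvd n"
      by (simp add: of_nat_eq_0_iff_char_dvd)
    moreover have "CHAR('k) dvd q"
      unfolding q by (rule CHAR_dvd_CARD)
    ultimately have "CHAR('k) = 1"
      using coprime by (metis coprime_common_divisor_nat)
    then show False
      by simp
  qed
  interpret unity_factorization n r s f F1 G1 \<alpha>
  proof
    show "\<exists>F2. [:-1, 1:] * F1 j + f j * F2 = 1" "\<exists>G2. [:1, 1:] * G1 j + f j * G2 = 1"
      if "zeta n < j" "j \<le> r" for j
      using bezout_F[of j] bezout_G[of j] that by auto
  qed (use unit factorization monic_irreducible zeta_le f_1 f_2 self_reciprocal root in auto)
  note proj_eps = proj_eps[where 'n = 'n, OF n(1)]
  have inj: "u = v" if "\<P>all u = \<P>all v" for u v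
  proof (rule proj_jointly_inj[OF n(1)])
    show "proj n r \<alpha> j u = proj n r \<alpha> j v" if "j \<in> {1..r+s}" for j
      using fun_cong[OF \<open>\<P>all u = \<P>all v\<close>, of j] that by (simp add: \<P>all_def)
  qed
  have sum: "\<P>all (\<Sum>j=1..r+s. \<epsilon> j (w j)) = w" if "w \<in> PiE {1..r+s} (\<lambda>j. carrier (A j))" for w
  proof
    fix i
    show "\<P>all (\<Sum>j=1..r+s. \<epsilon> j (w j)) i = w i"
      using that proj_sum_eps[OF n(1), of i "{1..r+s}" w]
      by (auto simp: \<P>all_def \<epsilon>_def A_def PiE_iff extensional_def)
  qed
  have in_PiE: "\<P>all u \<in> PiE {1..r+s} (\<lambda>j. carrier (A j))" for u
    unfolding \<P>all_def A_def using proj_closed[OF n(1)] by (intro restrict_PiE_iff[THEN iffD2]) blast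
  show ?thesis
  proof (intro conjI ballI impI)
    show "\<exists>!u :: 'n dih \<Rightarrow>\<^sub>0 'k. eps_graph n r f F1 G1 \<alpha> j Y u" if "j \<in> {1..r+s}" "Y \<in> carrier (A j)" for j Y
      using eps_graph_total[where 'n = 'n] eps_graph_unique[OF n(1)] that unfolding A_def by blast
    show "bij_betw \<P>all UNIV (PiE {1..r+s} (\<lambda>j. carrier (A j)))"
    proof (rule bij_betwI')
      show "\<exists>u\<in>UNIV. w = \<P>all u" if "w \<in> PiE {1..r+s} (\<lambda>j. carrier (A j))" for w
        using sum[OF that] by (metis UNIV_I)
    qed (use inj in_PiE in auto)
    show "inv_into UNIV \<P>all w = (\<Sum>j=1..r+s. \<epsilon> j (w j))" if "w \<in> PiE {1..r+s} (\<lambda>j. carrier (A j))" for w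
      using sum[OF that] inj by (metis f_inv_into_f rangeI)
    show "alg_mono (A j) grp_alg (\<epsilon> j)" if "j \<in> {1..r+s}" for j
      using eps_alg_mono[OF n(1) that] unfolding A_def \<epsilon>_def .
    show "\<P> j (\<epsilon> j Y) = Y" if "j \<in> {1..r+s}" "Y \<in> carrier (A j)" for j Y
      using proj_eps[of j j Y] that unfolding A_def \<epsilon>_def \<P>_def by simp
    show "\<P> i (\<epsilon> j Y) = \<zero>\<^bsub>A i\<^esub>" if "i \<in> {1..r+s}" "j \<in> {1..r+s}" "i \<noteq> j" "Y \<in> carrier (A j)" for i j Y
      using proj_eps[of i j Y] that unfolding A_def \<epsilon>_def \<P>_def by simp
  qed
qed

end
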